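(* Let $A$ and $B$ be separable, unital $C^*$-algebras and let $\varphi:A\to B$ be an injective unital $*$-homomorphism. Equip $A$ and $B$ with computable presentations $A^\dagger$ and $B^\#$ respectively. Suppose that: (1) $1$ is a computable point of $B^\#$; (2) $\varphi:A^\dagger\to B^\#$ is a computable map; (3) there is a sequence of unitaries $(w_n)_{n\in\mathbb N}$ from $B$ such that $\lim_{n\to\infty}\|w_n\varphi(a)-\varphi(a)w_n\|=0$ and $\lim_{n\to\infty}d(w_n^*bw_n,\varphi(A))=0$ for all $a\in A$ and $b\in B$. Then there is a computable isomorphism $\psi:A^\dagger\to B^\#$ that is computably approximately unitarily equivalent to $\varphi$.
   Context: All $C^*$-algebras and $*$-homomorphisms are unital. A presentation of a separable $C^*$-algebra $A$ is a pair $A^\dagger=(A,(a_n)_{n\in\mathbb N})$ where $\{a_n\}$ generates $A$ as a $C^*$-algebra; the $a_n$ are its special points. A rational polynomial is a $*$-polynomial in noncommuting variables with coefficients in $\mathbb Q(i)$; fix an effective enumeration of these. The rational points of $A^\dagger$ are the elements $p(a_{i_1},\ldots,a_{i_k})$ with $p$ a rational polynomial; they are thereby effectively enumerated, and the index of a rational point in the enumeration is called a code for it. $A^\dagger$ is a computable presentation if there is an algorithm which, on input (a code for) a rational point $p$ of $A^\dagger$ and $k\in\mathbb N$, returns a rational number $q$ with $|\|p\|-q|<2^{-k}$. An element $x\in A$ is a computable point of $A^\dagger$ if there is an algorithm which, on input $k$, returns a rational point $q$ of $A^\dagger$ with $\|x-q\|<2^{-k}$; a code for $x$ is a natural number coding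 such an algorithm. A map $\varphi:A^\dagger\to B^\#$ is computable if $\varphi$ is a function $A\to B$ and there is an algorithm which, on input a rational point $p$ of $A^\dagger$ and $k\in\mathbb N$, returns a rational point $q$ of $B^\#$ with $\|\varphi(p)-q\|<2^{-k}$. A computable isomorphism is a $*$-isomorphism that is a computable map with computable inverse. A computable sequence in $B^\#$ is a sequence $(x_n)$ of computable points of $B^\#$ such that some computable function sends $n$ to a code for $x_n$. Two computable $*$-homomorphisms $\varphi,\psi:A^\dagger\to B^\#$ are computably approximately unitarily equivalent if there are a computable sequence $(v_n)_{n\in\mathbb N}$ in $B^\#$ consisting of unitaries and an algorithm which, given a code for a rational point $a$ of $A^\dagger$ and $m\in\mathbb N$, returns $n\in\mathbb N$ such that $\|v_n\varphi(a)v_n^*-\psi(a)\|<2^{-m}$. For $b\in B$, $d(b,\varphi(A))=\inf_{a\in A}\|b-\varphi(a)\|$. *)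

theory Defs
  imports "HOL-Analysis.Analysis" "HOL-Library.Nat_Bijection"
begin

section \<open>Unital C*-algebras\<close>

text \<open>
  The sort \<open>monoid_mult\<close> provides the unit without imposing \<open>0 \<noteq> 1\<close>, so the zero algebra is
  included; \<open>norm 1 = 1\<close> in a nonzero algebra follows from the C*-identity.
\<close>

class unital_cstar_algebra = real_normed_algebra + banach + monoid_mult +
  fixes scaleC :: "complex \<Rightarrow> 'a \<Rightarrow> 'a"
    and star :: "'a \<Rightarrow> 'a"
  assumes scaleC_add_right: "scaleC c (x + y) = scaleC c x + scaleC c y"
    and scaleC_add_left: "scaleC (c + d) x = scaleC c x + scaleC d x"
    and scaleC_scaleC: "scaleC c (scaleC d x) = scaleC (c * d) x"
    and scaleR_scaleC: "scaleR r x = scaleC (complex_of_real r) x"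
    and mult_scaleC_left': "scaleC c x * y = scaleC c (x * y)"
    and mult_scaleC_right': "x * scaleC c y = scaleC c (x * y)"
    and norm_scaleC: "norm (scaleC c x) = cmod c * norm x"
    and star_star: "star (star x) = x"
    and star_add: "star (x + y) = star x + star y"
    and star_scaleC: "star (scaleC c x) = scaleC (cnj c) (star x)"
    and star_mult: "star (x * y) = star y * star x"
    and cstar_identity: "norm (star x * x) = (norm x)\<^sup>2"

definition unitary :: "'a::unital_cstar_algebra \<Rightarrow> bool" where
  "unitary u \<longleftrightarrow> star u * u = 1 \<and> u * star u = 1"

definition star_hom :: "('a::unital_cstar_algebra \<Rightarrow> 'b::unital_cstar_algebra) \<Rightarrow> bool" where
  "star_hom \<phi> \<longleftrightarrow>
     (\<forall>x y. \<phi> (x + y) = \<phi> x + \<phi> y) \<and>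
     (\<forall>c x. \<phi> (scaleC c x) = scaleC c (\<phi> x)) \<and>
     (\<forall>x y. \<phi> (x * y) = \<phi> x * \<phi> y) \<and>
     (\<forall>x. \<phi> (star x) = star (\<phi> x)) \<and>
     \<phi> 1 = 1"

definition star_iso :: "('a::unital_cstar_algebra \<Rightarrow> 'b::unital_cstar_algebra) \<Rightarrow> bool" where
  "star_iso \<phi> \<longleftrightarrow> star_hom \<phi> \<and> bij \<phi>"


section \<open>Algorithms\<close>

text \<open>
  Programs for the partial recursive functions of one argument; tuples are passed through the
  Cantor pairing \<^const>\<open>prod_encode\<close>.  \<open>runs p x y\<close> says that \<open>p\<close> halts on input \<open>x\<close> with
  output \<open>y\<close>.
\<close>

datatype prog =
    Zero
  | Succ
  | Ident
  | Left
  | Right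
  | Pairing prog prog
  | Comp prog prog
  | PrimRec prog prog
  | Search prog

inductive runs :: "prog \<Rightarrow> nat \<Rightarrow> nat \<Rightarrow> bool" where
  "runs Zero x 0"
| "runs Succ x (Suc x)"
| "runs Ident x x"
| "runs Left (prod_encode (x, y)) x"
| "runs Right (prod_encode (x, y)) y"
| "runs p x y \<Longrightarrow> runs q x z \<Longrightarrow> runs (Pairing p q) x (prod_encode (y, z))"
| "runs q x y \<Longrightarrow> runs p y z \<Longrightarrow> runs (Comp p q) x z"
| "runs p x y \<Longrightarrow> runs (PrimRec p q) (prod_encode (x, 0)) y"
| "runs (PrimRec p q) (prod_encode (x, n)) y \<Longrightarrow>
   runs q (prod_encode (x, prod_encode (n, y))) z \<Longrightarrow>
   runs (PrimRec p q) (prod_encode (x, Suc n)) z"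
| "runs p (prod_encode (x, n)) 0 \<Longrightarrow>
   (\<forall>m<n. \<exists>y. runs p (prod_encode (x, m)) (Suc y)) \<Longrightarrow>
   runs (Search p) x n"

fun prog_code :: "prog \<Rightarrow> nat" where
  "prog_code Zero = prod_encode (0, 0)"
| "prog_code Succ = prod_encode (1, 0)"
| "prog_code Ident = prod_encode (2, 0)"
| "prog_code Left = prod_encode (3, 0)"
| "prog_code Right = prod_encode (4, 0)"
| "prog_code (Pairing p q) = prod_encode (5, prod_encode (prog_code p, prog_code q))"
| "prog_code (Comp p q) = prod_encode (6, prod_encode (prog_code p, prog_code q))"
| "prog_code (PrimRec p q) = prod_encode (7, prod_encode (prog_code p, prog_code q))"
| "prog_code (Search p) = prod_encode (8, prog_code p)"

lemma prog_code_inject: "prog_code p = prog_code q \<longleftrightarrow> p = q"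
proof (induction p arbitrary: q)
  case (Pairing p1 p2) then show ?case by (cases q) simp_all
next
  case (Comp p1 p2) then show ?case by (cases q) simp_all
next
  case (PrimRec p1 p2) then show ?case by (cases q) simp_all
next
  case (Search p) then show ?case by (cases q) simp_all
next
  case Zero then show ?case by (cases q) simp_all
next
  case Succ then show ?case by (cases q) simp_all
next
  case Ident then show ?case by (cases q) simp_all
next
  case Left then show ?case by (cases q) simp_all
next
  case Right then show ?case by (cases q) simp_all
qed

definition computable_fun :: "(nat \<Rightarrow> nat) \<Rightarrow> bool" where
  "computable_fun f \<longleftrightarrow> (\<exists>p. \<forall>x. runs p x (f x))"

definition computable_fun2 :: "(nat \<Rightarrow> nat \<Rightarrow> nat) \<Rightarrow> bool" where
  "computable_fun2 f \<longleftrightarrow> (\<exists>p. \<forall>x y. runs p (prod_encode (x, y)) (f x y))"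


section \<open>Rational polynomials and rational points\<close>

definition rat_of_code :: "nat \<Rightarrow> rat" where
  "rat_of_code n = (case prod_decode n of (i, d) \<Rightarrow> of_int (int_decode i) / of_nat (Suc d))"

text \<open>
  A rational polynomial is given as a formal sum of terms; a term is a pair consisting of the real
  and imaginary part of its coefficient together with a word of letters.  The letter \<open>(i, False)\<close>
  is the variable \<open>x\<^sub>i\<close>, the letter \<open>(i, True)\<close> is its adjoint, and the empty word is the constant
  monomial.

  Whether rational polynomials may have a constant term is a matter of convention, and the
  parameter \<open>ct\<close> below records the choice (for \<open>ct = False\<close> constant terms are excluded).  If they
  are allowed, the unit is always a rational point and a sequence presents the algebra if it
  generates it as a unital C*-algebra; if they are excluded, it has to generate it as a
  C*-algebra without help of the unit.
\<close>

type_synonym word = "(nat \<times> bool) list"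
type_synonym rat_poly = "((rat \<times> rat) \<times> word) list"

definition letter_of_code :: "nat \<Rightarrow> nat \<times> bool" where
  "letter_of_code n = (n div 2, odd n)"

text \<open>\<open>list_decode\<close> maps \<open>0\<close> to \<open>[]\<close> and the positive numbers bijectively to nonempty lists.\<close>

definition word_of_code :: "bool \<Rightarrow> nat \<Rightarrow> word" where
  "word_of_code ct n = map letter_of_code (list_decode (if ct then n else Suc n))"

definition coeff_of_code :: "nat \<Rightarrow> rat \<times> rat" where
  "coeff_of_code n = (case prod_decode n of (i, j) \<Rightarrow> (rat_of_code i, rat_of_code j))"

definition poly_of_code :: "bool \<Rightarrow> nat \<Rightarrow> rat_poly" where
  "poly_of_code ct n =
     map (\<lambda>t. case prod_decode t of (i, j) \<Rightarrow> (coeff_of_code i, word_of_code ct j)) (list_decode n)"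

definition eval_word :: "(nat \<Rightarrow> 'a::unital_cstar_algebra) \<Rightarrow> word \<Rightarrow> 'a" where
  "eval_word a w = prod_list (map (\<lambda>(i, s). if s then star (a i) else a i) w)"

definition eval_poly :: "(nat \<Rightarrow> 'a::unital_cstar_algebra) \<Rightarrow> rat_poly \<Rightarrow> 'a" where
  "eval_poly a P =
     sum_list (map (\<lambda>((r, s), w). scaleC (Complex (of_rat r) (of_rat s)) (eval_word a w)) P)"

text \<open>The rational point with code \<open>n\<close>.\<close>

definition rat_point :: "bool \<Rightarrow> (nat \<Rightarrow> 'a::unital_cstar_algebra) \<Rightarrow> nat \<Rightarrow> 'a" where
  "rat_point ct a n = eval_poly a (poly_of_code ct n)"


section \<open>Computable presentations\<close>

text \<open>
  A presentation of the C*-algebra \<open>'a\<close> is given by its sequence \<open>a :: nat \<Rightarrow> 'a\<close> of special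
  points.
\<close>

definition cstar_subalgebra :: "bool \<Rightarrow> 'a::unital_cstar_algebra set \<Rightarrow> bool" where
  "cstar_subalgebra ct S \<longleftrightarrow>
     closed S \<and> 0 \<in> S \<and> (ct \<longrightarrow> 1 \<in> S) \<and>
     (\<forall>x\<in>S. \<forall>y\<in>S. x + y \<in> S) \<and>
     (\<forall>c. \<forall>x\<in>S. scaleC c x \<in> S) \<and>
     (\<forall>x\<in>S. \<forall>y\<in>S. x * y \<in> S) \<and>
     (\<forall>x\<in>S. star x \<in> S)"

definition presentation :: "bool \<Rightarrow> (nat \<Rightarrow> 'a::unital_cstar_algebra) \<Rightarrow> bool" where
  "presentation ct a \<longleftrightarrow> cstar_subalgebra ct hull range a = UNIV"

definition computable_presentation :: "bool \<Rightarrow> (nat \<Rightarrow> 'a::unital_cstar_algebra) \<Rightarrow> bool" where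
  "computable_presentation ct a \<longleftrightarrow>
     presentation ct a \<and>
     (\<exists>f. computable_fun2 f \<and>
          (\<forall>n k. \<bar>norm (rat_point ct a n) - of_rat (rat_of_code (f n k))\<bar> < 1 / 2 ^ k))"

text \<open>\<open>e\<close> is a code for the point \<open>x\<close>.\<close>

definition point_code ::
  "bool \<Rightarrow> (nat \<Rightarrow> 'a::unital_cstar_algebra) \<Rightarrow> nat \<Rightarrow> 'a \<Rightarrow> bool" where
  "point_code ct a e x \<longleftrightarrow>
     (\<exists>p. prog_code p = e \<and>
          (\<forall>k. \<exists>n. runs p k n \<and> norm (x - rat_point ct a n) < 1 / 2 ^ k))"

definition computable_point :: "bool \<Rightarrow> (nat \<Rightarrow> 'a::unital_cstar_algebra) \<Rightarrow> 'a \<Rightarrow> bool" where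
  "computable_point ct a x \<longleftrightarrow> (\<exists>e. point_code ct a e x)"

definition computable_sequence ::
  "bool \<Rightarrow> (nat \<Rightarrow> 'a::unital_cstar_algebra) \<Rightarrow> (nat \<Rightarrow> 'a) \<Rightarrow> bool" where
  "computable_sequence ct a x \<longleftrightarrow>
     (\<exists>g. computable_fun g \<and> (\<forall>n. point_code ct a (g n) (x n)))"

definition computable_map ::
  "bool \<Rightarrow> (nat \<Rightarrow> 'a::unital_cstar_algebra) \<Rightarrow> (nat \<Rightarrow> 'b::unital_cstar_algebra) \<Rightarrow>
   ('a \<Rightarrow> 'b) \<Rightarrow> bool" where
  "computable_map ct a b \<phi> \<longleftrightarrow>
     (\<exists>f. computable_fun2 f \<and>
          (\<forall>n k. norm (\<phi> (rat_point ct a n) - rat_point ct b (f n k)) < 1 / 2 ^ k))"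

definition computable_isomorphism ::
  "bool \<Rightarrow> (nat \<Rightarrow> 'a::unital_cstar_algebra) \<Rightarrow> (nat \<Rightarrow> 'b::unital_cstar_algebra) \<Rightarrow>
   ('a \<Rightarrow> 'b) \<Rightarrow> bool" where
  "computable_isomorphism ct a b \<psi> \<longleftrightarrow>
     star_iso \<psi> \<and> computable_map ct a b \<psi> \<and> computable_map ct b a (inv \<psi>)"

definition computably_approx_unitarily_equivalent ::
  "bool \<Rightarrow> (nat \<Rightarrow> 'a::unital_cstar_algebra) \<Rightarrow> (nat \<Rightarrow> 'b::unital_cstar_algebra) \<Rightarrow>
   ('a \<Rightarrow> 'b) \<Rightarrow> ('a \<Rightarrow> 'b) \<Rightarrow> bool" where
  "computably_approx_unitarily_equivalent ct a b \<phi> \<psi> \<longleftrightarrow>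
     (\<exists>v. computable_sequence ct b v \<and> (\<forall>n. unitary (v n)) \<and>
        (\<exists>f. computable_fun2 f \<and>
           (\<forall>i m. norm (v (f i m) * \<phi> (rat_point ct a i) * star (v (f i m))
                         - \<psi> (rat_point ct a i)) < 1 / 2 ^ m)))"

end

theory Submission
  imports Defs
begin

text \<open>
  The theorem is an effective version of Elliott's one-sided approximate intertwining. Suppose that
  unitaries \<open>v\<^sub>n\<close> of \<open>B\<close> are found one after the other such that \<open>v\<^sub>n\<^sub>+\<^sub>1\<close> and \<open>v\<^sub>n\<close> conjugate more and more
  elements of \<open>\<phi>(A)\<close> to almost the same place, with errors that are summable, while conjugation by
  \<open>v\<^sub>n\<^sub>+\<^sub>1\<close> brings some \<open>\<phi>(x)\<close> close to the next element of a sequence in \<open>B\<close> in which every rational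
  point recurs, where this \<open>x\<close> is one of the elements that later steps hardly move. Then \<open>\<psi>(x) = lim v\<^sub>n \<phi>(x) v\<^sub>n\<^sup>*\<close> exists, is an isometric
  homomorphism because \<open>\<phi>\<close> is one, and has dense, hence full, range. The next unitary can be
  taken to be \<open>v\<^sub>n w\<^sub>m\<close> for large \<open>m\<close>, since \<open>w\<^sub>m\<close> almost commutes with finitely many given
  elements of \<open>\<phi>(A)\<close> and \<open>w\<^sub>m\<^sup>* (v\<^sub>n\<^sup>* y v\<^sub>n) w\<^sub>m\<close> is close to \<open>\<phi>(A)\<close> (lemma \<open>intertwining_step\<close>).

  The construction becomes effective because every requirement on a step is an open condition that
  can be tested, up to a factor 2, by computing norms of rational points. So the unitaries are
  replaced by almost unitary rational points \<open>c\<^sub>n\<close>, which are found by unbounded search; the search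
  succeeds since rational points are dense, and the resulting sequence is computable
  (\<open>effective_dependent_choice\<close>). The rate of convergence is built into the tests, so \<open>\<psi>\<close> is
  computable, and the search also yields preimages, so \<open>\<psi>\<^sup>-\<^sup>1\<close> is computable. How close \<open>c\<^sub>n\<close> has to be to
  a unitary depends on the norms of the elements tracked so far, for which computable bounds exist.

  Genuine unitaries \<open>v\<^sub>n\<close> come from \<open>c\<^sub>n\<close> by the Newton iteration \<open>u \<mapsto> (3 u - u u\<^sup>* u) / 2\<close> for the unitary
  part. It sends rational points to rational points, whether or not the unit is one, and it
  converges at a known rate as soon as \<open>u\<close> is almost unitary (\<open>newton_limit\<close>); this gives programs
  for \<open>v\<^sub>n\<close>, uniformly in \<open>n\<close>.

  That \<open>\<phi>\<close> is isometric is obtained without spectral theory. For \<open>\<parallel>a\<parallel> \<le> 1\<close> self-adjoint, \<open>1 - a\<close> has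
  a square root that is a limit of polynomials in \<open>a\<close> (\<open>sqrt_one_minus\<close>). So a self-adjoint \<open>h\<close> with
  \<open>\<parallel>h\<parallel> \<le> 1\<close> is the real part of the unitary \<open>h + i \<surd>(1 - h\<^sup>2)\<close>, as is its image, whence \<open>\<phi>\<close> is
  contractive; and a single absolute value \<open>\<bar>c\<bar> = \<surd>(c\<^sup>2)\<close> is all that is needed of the functional calculus to see
  that an injective \<open>\<phi>\<close> does not decrease norms (\<open>inj_star_hom_norm_eq\<close>).

  Programs are handled through closure properties of the computable functions, collected in
  \<open>computable_intros\<close>; they include recursion over coded lists, by which the algebraic operations
  on codes of rational points are computed.
\<close>

section \<open>Closure properties of the computable functions\<close>

abbreviation pfst :: "nat \<Rightarrow> nat" where "pfst z \<equiv> fst (prod_decode z)"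
abbreviation psnd :: "nat \<Rightarrow> nat" where "psnd z \<equiv> snd (prod_decode z)"

text \<open>
  Truth is coded by \<open>0\<close> because that is the value for which \<^const>\<open>Search\<close> stops.
\<close>

definition computable_pred :: "(nat \<Rightarrow> bool) \<Rightarrow> bool" where
  "computable_pred P \<longleftrightarrow> computable_fun (\<lambda>x. if P x then 0 else 1)"

text \<open>
  The rules collected here have conclusions like \<open>computable_fun (\<lambda>x. f x + g x)\<close>, so that computability of
  a term follows by decomposing it with \<open>intro\<close>. Further arguments, and the context \<open>x\<close> in which a local
  function \<open>F x\<close> is iterated or mapped over a list, are passed as one component of a pair.
\<close>

named_theorems computable_intros

lemma computable_id [computable_intros]: "computable_fun (\<lambda>x. x)"
  unfolding computable_fun_def by (blast intro: runs.intros)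

lemma computable_comp:
  assumes "computable_fun f" "computable_fun g" shows "computable_fun (\<lambda>x. f (g x))"
  using assms unfolding computable_fun_def by (meson runs.intros(7))

lemma computable_Suc [computable_intros]:
  "computable_fun f \<Longrightarrow> computable_fun (\<lambda>x. Suc (f x))"
  by (rule computable_comp[of Suc]) (auto simp: computable_fun_def intro: runs.intros)

lemma computable_const [computable_intros]: "computable_fun (\<lambda>x. c)"
proof (induction c)
  case 0 then show ?case unfolding computable_fun_def by (blast intro: runs.intros)
qed (rule computable_Suc)

lemma computable_pair [computable_intros]:
  "computable_fun f \<Longrightarrow> computable_fun g \<Longrightarrow> computable_fun (\<lambda>x. prod_encode (f x, g x))"
  unfolding computable_fun_def by (meson runs.intros(6))

lemma computable_pfst [computable_intros]:
  "computable_fun f \<Longrightarrow> computable_fun (\<lambda>x. pfst (f x))"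
proof (rule computable_comp[of pfst])
  have "runs Left z (pfst z)" for z
    using runs.intros(4)[of "pfst z" "psnd z"] by simp
  then show "computable_fun pfst" unfolding computable_fun_def by blast
qed

lemma computable_psnd [computable_intros]:
  "computable_fun f \<Longrightarrow> computable_fun (\<lambda>x. psnd (f x))"
proof (rule computable_comp[of psnd])
  have "runs Right z (psnd z)" for z
    using runs.intros(5)[of "pfst z" "psnd z"] by simp
  then show "computable_fun psnd" unfolding computable_fun_def by blast
qed

lemma computable_fun2_iff: "computable_fun2 f \<longleftrightarrow> computable_fun (\<lambda>z. f (pfst z) (psnd z))"
  unfolding computable_fun2_def computable_fun_def
  by (metis fst_conv prod.collapse prod_decode_inverse prod_encode_inverse snd_conv)

lemma computable_app2:
  assumes "computable_fun2 h" "computable_fun f" "computable_fun g"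
  shows "computable_fun (\<lambda>x. h (f x) (g x))"
  using computable_comp[OF assms(1)[unfolded computable_fun2_iff] computable_pair[OF assms(2,3)]]
  by simp

lemma computable_app2':
  assumes "computable_fun (\<lambda>z. h (pfst z) (psnd z))" "computable_fun f" "computable_fun g"
  shows "computable_fun (\<lambda>x. h (f x) (g x))"
  using computable_app2[unfolded computable_fun2_iff, OF assms] .

lemma computable_app3:
  assumes "computable_fun (\<lambda>z. h (pfst z) (pfst (psnd z)) (psnd (psnd z)))"
    "computable_fun f" "computable_fun g" "computable_fun k"
  shows "computable_fun (\<lambda>x. h (f x) (g x) (k x))"
  using computable_comp[OF assms(1) computable_pair[OF assms(2) computable_pair[OF assms(3,4)]]]
  by simp

lemma computable_rec_nat [computable_intros]:
  assumes b: "computable_fun b" and m: "computable_fun m"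
    and st: "computable_fun (\<lambda>z. st (pfst z) (pfst (psnd z)) (psnd (psnd z)))"
  shows "computable_fun (\<lambda>x. rec_nat (b x) (st x) (m x))"
proof -
  obtain p q where p: "\<And>x. runs p x (b x)"
    and q: "\<And>z. runs q z (st (pfst z) (pfst (psnd z)) (psnd (psnd z)))"
    using b st unfolding computable_fun_def by blast
  have "runs (PrimRec p q) (prod_encode (x, n)) (rec_nat (b x) (st x) n)" for x n
  proof (induction n)
    case (Suc n)
    show ?case
      using runs.intros(9)[OF Suc] q[of "prod_encode (x, prod_encode (n, rec_nat (b x) (st x) n))"]
      by simp
  qed (simp add: runs.intros(8) p)
  then have "computable_fun2 (\<lambda>x n. rec_nat (b x) (st x) n)"
    unfolding computable_fun2_def by blast
  from computable_app2[OF this computable_id m] show ?thesis .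
qed

lemma computable_funpow [computable_intros]:
  assumes "computable_fun (\<lambda>z. F (pfst z) (psnd z))" "computable_fun n" "computable_fun s"
  shows "computable_fun (\<lambda>x. (F x ^^ n x) (s x))"
proof -
  have *: "(F x ^^ m) y = rec_nat y (\<lambda>_ acc. F x acc) m" for x m y by (induction m) auto
  show ?thesis unfolding *
    by (intro computable_intros computable_app2'[where h=F, OF assms(1)] assms(2,3))
qed

lemma computable_if [computable_intros]:
  assumes "computable_pred P" "computable_fun f" "computable_fun g"
  shows "computable_fun (\<lambda>x. if P x then f x else g x)"
proof -
  have *: "(if P x then f x else g x) = rec_nat (f x) (\<lambda>_ _. g x) (if P x then 0 else 1)" for x
    by simp
  show ?thesis unfolding *
    by (intro computable_intros assms(2,3) assms(1)[unfolded computable_pred_def]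
        computable_comp[OF assms(3)])
qed

lemma computable_minus1: "computable_fun f \<Longrightarrow> computable_fun (\<lambda>x. f x - 1)"
proof -
  assume f: "computable_fun f"
  have *: "f x - 1 = rec_nat 0 (\<lambda>n _. n) (f x)" for x by (cases "f x") auto
  show ?thesis unfolding * by (intro computable_intros f)
qed

lemma computable_minus [computable_intros]:
  assumes "computable_fun f" "computable_fun g" shows "computable_fun (\<lambda>x. f x - g x)"
proof -
  have *: "a - b = ((\<lambda>y. y - 1) ^^ b) a" for a b :: nat by (induction b) auto
  show ?thesis unfolding *[of "f _"] by (intro computable_intros computable_minus1 assms)
qed

lemma computable_plus [computable_intros]:
  assumes "computable_fun f" "computable_fun g" shows "computable_fun (\<lambda>x. f x + g x)"
proof -
  have *: "a + b = (Suc ^^ b) a" for a b :: nat by (induction b) auto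
  show ?thesis unfolding *[of "f _"] by (intro computable_intros assms)
qed

lemma computable_times [computable_intros]:
  assumes "computable_fun f" "computable_fun g" shows "computable_fun (\<lambda>x. f x * g x)"
proof -
  have *: "a * b = rec_nat 0 (\<lambda>_ y. y + a) b" for a b :: nat by (induction b) auto
  show ?thesis unfolding *[of "f _"]
    by (intro computable_intros assms computable_comp[OF assms(1)])
qed

lemma computable_power [computable_intros]:
  assumes "computable_fun f" "computable_fun g" shows "computable_fun (\<lambda>x. f x ^ g x)"
proof -
  have *: "a ^ b = rec_nat 1 (\<lambda>_ y. y * a) b" for a b :: nat by (induction b) auto
  show ?thesis unfolding *[of "f _"]
    by (intro computable_intros assms computable_comp[OF assms(1)])
qed

lemma computable_sum [computable_intros]:
  assumes "computable_fun (\<lambda>z. f (pfst z) (psnd z))" "computable_fun m"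
  shows "computable_fun (\<lambda>x. \<Sum>i<m x. f x i)"
proof -
  have *: "(\<Sum>i<n. f x i) = rec_nat 0 (\<lambda>i y. y + f x i) n" for x n by (induction n) auto
  show ?thesis unfolding *
    by (intro computable_intros computable_app2'[where h=f, OF assms(1)] assms(2))
qed

lemma computable_pred_comp:
  assumes "computable_pred P" "computable_fun g" shows "computable_pred (\<lambda>x. P (g x))"
  using computable_comp[OF assms(1)[unfolded computable_pred_def] assms(2)]
  by (simp add: computable_pred_def)

lemma computable_pred_eq_0:
  assumes "computable_fun f" shows "computable_pred (\<lambda>x. f x = 0)"
proof -
  have *: "(if f x = 0 then 0 else 1) = 1 - (1 - f x)" for x by simp
  show ?thesis unfolding computable_pred_def * by (intro computable_intros assms)
qed

lemma computable_pred_le [computable_intros]: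
  assumes "computable_fun f" "computable_fun g" shows "computable_pred (\<lambda>x. f x \<le> g x)"
  using computable_pred_eq_0[OF computable_minus[OF assms]] by simp

lemma computable_pred_less [computable_intros]:
  assumes "computable_fun f" "computable_fun g" shows "computable_pred (\<lambda>x. f x < g x)"
  using computable_pred_le[OF computable_Suc[OF assms(1)] assms(2)] by (simp add: Suc_le_eq)

lemma computable_pred_conj [computable_intros]:
  assumes "computable_pred P" "computable_pred Q" shows "computable_pred (\<lambda>x. P x \<and> Q x)"
proof -
  have *: "(if P x \<and> Q x then 0 else 1) = (if P x then if Q x then 0 else 1 else 1 :: nat)" for x
    by simp
  show ?thesis unfolding computable_pred_def * by (intro computable_intros assms)
qed

lemma computable_pred_eq [computable_intros]:
  assumes "computable_fun f" "computable_fun g" shows "computable_pred (\<lambda>x. f x = g x)"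
proof -
  have "computable_pred (\<lambda>x. f x \<le> g x \<and> g x \<le> f x)" by (intro computable_intros assms)
  then show ?thesis by (simp only: order_eq_iff)
qed

lemma computable_pred_ball [computable_intros]:
  assumes "computable_pred (\<lambda>z. Q (pfst z) (psnd z))" "computable_fun m"
  shows "computable_pred (\<lambda>x. \<forall>i<m x. Q x i)"
proof -
  have "computable_pred (\<lambda>x. (\<Sum>i<m x. if Q x i then 0 else 1) = (0::nat))"
    by (intro computable_intros assms)
  moreover have "(\<Sum>i<m x. if Q x i then 0 else 1) = (0::nat) \<longleftrightarrow> (\<forall>i<m x. Q x i)" for x by auto
  ultimately show ?thesis by simp
qed

lemma computable_pred_even [computable_intros]:
  assumes "computable_fun f" shows "computable_pred (\<lambda>x. even (f x))"
proof -
  have *: "even a \<longleftrightarrow> ((\<lambda>y. 1 - y) ^^ a) 0 = (0::nat)" for a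
  proof -
    have "((\<lambda>y. 1 - y) ^^ a) 0 = (if even a then 0 else 1 :: nat)" by (induction a) auto
    then show ?thesis by simp
  qed
  show ?thesis unfolding * by (intro computable_intros assms)
qed

lemma runs_Search_Least:
  assumes "\<And>n. runs p (prod_encode (x, n)) (if P n then 0 else 1)" and "\<exists>n. P n"
  shows "runs (Search p) x (LEAST n. P n)"
proof (rule runs.intros(10))
  show "runs p (prod_encode (x, LEAST n. P n)) 0"
    using assms(1)[of "LEAST n. P n"] LeastI_ex[OF assms(2)] by simp
  show "\<forall>m<LEAST n. P n. \<exists>y. runs p (prod_encode (x, m)) (Suc y)"
    using assms(1) not_less_Least by (metis One_nat_def)
qed

lemma computable_Least:
  assumes "computable_pred (\<lambda>z. P (pfst z) (psnd z))" "\<And>x. \<exists>n. P x n"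
  shows "computable_fun (\<lambda>x. LEAST n. P x n)"
proof -
  obtain p where p: "\<And>z. runs p z (if P (pfst z) (psnd z) then 0 else 1)"
    using assms(1) unfolding computable_pred_def computable_fun_def by blast
  have "runs (Search p) x (LEAST n. P x n)" for x
    using p[of "prod_encode (x, _)"] by (intro runs_Search_Least assms(2)) simp
  then show ?thesis unfolding computable_fun_def by blast
qed

lemma computable_div2 [computable_intros]:
  assumes "computable_fun f" shows "computable_fun (\<lambda>x. f x div 2)"
proof (rule computable_comp[OF _ assms])
  have "n div 2 = (LEAST q. n < 2 * Suc q)" for n :: nat
    by (rule sym, rule Least_equality) auto
  moreover have "computable_fun (\<lambda>n. LEAST q. n < 2 * Suc q)"
  proof (intro computable_Least computable_intros)
    show "\<exists>q. n < 2 * Suc q" for n by (rule exI[of _ n]) simp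
  qed
  ultimately show "computable_fun (\<lambda>n. n div 2)" by simp
qed

section \<open>Effective dependent choice\<close>

text \<open>
  A search that succeeds only for inputs \<open>s\<close> with \<open>I n s\<close> is a partial function, and its iteration is
  not covered by the closure properties of total functions. But the search does succeed along the one
  sequence that the iteration generates, since the invariant is preserved, and this suffices to run the
  primitive recursion.
\<close>

lemma effective_dependent_choice:
  assumes P: "computable_pred (\<lambda>z. P (pfst z) (pfst (psnd z)) (psnd (psnd z)))"
    and init: "I 0 s0"
    and ex: "\<And>n s. I n s \<Longrightarrow> \<exists>t. P n s t"
    and step: "\<And>n s t. I n s \<Longrightarrow> P n s t \<Longrightarrow> I (Suc n) t"
  obtains s where "computable_fun s" "s 0 = s0" "\<And>n. I n (s n)" "\<And>n. P n (s n) (s (Suc n))"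
proof -
  define s where "s = rec_nat s0 (\<lambda>n y. LEAST t. P n y t)"
  have s0: "s 0 = s0" and sS: "s (Suc n) = (LEAST t. P n (s n) t)" for n by (auto simp: s_def)
  have I: "I n (s n)" for n
  proof (induction n)
    case (Suc n) then show ?case unfolding sS by (meson LeastI_ex ex step)
  qed (simp add: s0 init)
  have Ps: "P n (s n) (s (Suc n))" for n unfolding sS by (rule LeastI_ex[OF ex[OF I]])
  have "computable_pred (\<lambda>w. P (pfst (psnd (pfst w))) (psnd (psnd (pfst w))) (psnd w))"
    using computable_pred_comp[OF P, of
        "\<lambda>w. prod_encode (pfst (psnd (pfst w)), prod_encode (psnd (psnd (pfst w)), psnd w))"]
    by (simp add: computable_intros)
  then obtain p where p:
    "\<And>w. runs p w (if P (pfst (psnd (pfst w))) (psnd (psnd (pfst w))) (psnd w) then 0 else 1)"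
    unfolding computable_pred_def computable_fun_def by blast
  obtain q where q: "\<And>x. runs q x s0" using computable_const unfolding computable_fun_def by blast
  \<comment> \<open>The recursion has no parameter; \<open>0\<close> is a dummy in its place.\<close>
  have "runs (PrimRec q (Search p)) (prod_encode (0, n)) (s n)" for n
  proof (induction n)
    case (Suc n)
    have "runs (Search p) (prod_encode (0, prod_encode (n, s n))) (s (Suc n))"
      unfolding sS using p[of "prod_encode (prod_encode (0, prod_encode (n, s n)), _)"] ex[OF I]
      by (intro runs_Search_Least) simp_all
    with Suc show ?case by (rule runs.intros(9))
  qed (simp add: s0 runs.intros(8) q)
  moreover obtain r where "\<And>n. runs r n (prod_encode (0, n))"
    using computable_pair[OF computable_const computable_id] unfolding computable_fun_def by blast
  ultimately have "computable_fun s" unfolding computable_fun_def by (meson runs.intros(7))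
  then show ?thesis using that s0 I Ps by blast
qed

section \<open>Uniform sequences of programs\<close>

primrec const_prog :: "nat \<Rightarrow> prog" where
  "const_prog 0 = Zero"
| "const_prog (Suc n) = Comp Succ (const_prog n)"

lemma runs_const_prog: "runs (const_prog n) x n"
  by (induction n) (auto intro: runs.intros)

text \<open>
  The s-m-n theorem: plugging the constant \<open>n\<close> into a program for \<open>h\<close> is an operation on programs whose
  effect on codes is computable, because the constant program is built by a recursion over \<open>n\<close>.
\<close>

lemma computable_specialization:
  assumes "computable_fun2 h"
  obtains p where "computable_fun (\<lambda>n. prog_code (p n))" "\<And>n k. runs (p n) k (h n k)"
proof -
  obtain q where q: "\<And>n k. runs q (prod_encode (n, k)) (h n k)"
    using assms unfolding computable_fun2_def by blast
  define p where "p n = Comp q (Pairing (const_prog n) Ident)" for n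
  have "prog_code (const_prog n) = rec_nat (prog_code Zero)
      (\<lambda>_ y. prod_encode (6, prod_encode (prog_code Succ, y))) n" for n
    by (induction n) auto
  then have "computable_fun (\<lambda>n. prog_code (p n))"
    unfolding p_def prog_code.simps(6,7) by (simp only:) (intro computable_intros)
  moreover have "runs (p n) k (h n k)" for n k
    unfolding p_def by (meson q runs.intros runs_const_prog)
  ultimately show ?thesis using that by blast
qed

section \<open>Operations on coded lists\<close>

lemma length_le_list_encode: "length xs \<le> list_encode xs"
proof (induction xs)
  case (Cons x xs)
  then show ?case using le_prod_encode_2[of "list_encode xs" x] by simp
qed simp

text \<open>
  The fold is run as a loop on pairs consisting of the code of the remaining list and the accumulator.
  The code of a list is at least its length, so it can serve as the number of iterations; the
  superfluous ones do nothing.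
\<close>

lemma computable_fold_list:
  assumes F: "computable_fun (\<lambda>z. F (pfst z) (pfst (psnd z)) (psnd (psnd z)))"
    and l: "computable_fun l" and s: "computable_fun s"
  shows "computable_fun (\<lambda>x. fold (F x) (list_decode (l x)) (s x))"
proof -
  define G where "G x st = (if pfst st = 0 then st else
      prod_encode (psnd (pfst st - 1), F x (pfst (pfst st - 1)) (psnd st)))" for x st
  have G: "(G x ^^ n) (prod_encode (list_encode xs, y)) = prod_encode (0, fold (F x) xs y)"
    if "length xs \<le> n" for x n xs y
    using that
  proof (induction n arbitrary: xs y)
    case (Suc n)
    show ?case
    proof (cases xs)
      case Nil
      then show ?thesis using Suc.IH[of "[]" y] by (simp add: funpow_swap1 G_def)
    next
      case (Cons a ys)
      have "G x (prod_encode (list_encode xs, y)) = prod_encode (list_encode ys, F x a y)"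
        by (simp add: G_def Cons)
      then show ?thesis using Suc Cons by (simp add: funpow_swap1)
    qed
  qed simp
  have "fold (F x) (list_decode (l x)) (s x) = psnd ((G x ^^ l x) (prod_encode (l x, s x)))" for x
    using G[of "list_decode (l x)" "l x" x "s x"] length_le_list_encode[of "list_decode (l x)"] by simp
  moreover have "computable_fun (\<lambda>z. G (pfst z) (psnd z))"
    unfolding G_def by (intro computable_intros computable_app3[where h=F, OF F])
  ultimately show ?thesis by (simp only:) (intro computable_intros l s)
qed

lemma fold_Cons_code:
  "fold (\<lambda>t s. Suc (prod_encode (t, s))) xs n = list_encode (rev xs @ list_decode n)"
  by (induction xs arbitrary: n) auto

lemma computable_rev [computable_intros]:
  assumes "computable_fun l" shows "computable_fun (\<lambda>x. list_encode (rev (list_decode (l x))))"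
  using computable_fold_list[of "\<lambda>_ t s. Suc (prod_encode (t, s))" l "\<lambda>_. 0"] assms
  by (simp add: fold_Cons_code computable_intros)

lemma computable_foldr_list:
  assumes F: "computable_fun (\<lambda>z. F (pfst z) (pfst (psnd z)) (psnd (psnd z)))"
    and l: "computable_fun l" and s: "computable_fun s"
  shows "computable_fun (\<lambda>x. foldr (F x) (list_decode (l x)) (s x))"
  using computable_fold_list[OF F computable_rev[OF l] s] by (simp add: foldr_conv_fold)

lemma computable_append [computable_intros]:
  assumes "computable_fun f" "computable_fun g"
  shows "computable_fun (\<lambda>x. list_encode (list_decode (f x) @ list_decode (g x)))"
  using computable_fold_list[of "\<lambda>_ t s. Suc (prod_encode (t, s))" "\<lambda>x. list_encode (rev (list_decode (f x)))" g] assms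
  by (simp add: fold_Cons_code computable_intros)

lemma computable_map [computable_intros]:
  assumes F: "computable_fun (\<lambda>z. F (pfst z) (psnd z))" and l: "computable_fun l"
  shows "computable_fun (\<lambda>x. list_encode (map (F x) (list_decode (l x))))"
proof -
  have *: "list_encode (map (F x) xs) = foldr (\<lambda>t s. Suc (prod_encode (F x t, s))) xs 0" for x xs
    by (induction xs) auto
  show ?thesis unfolding *
    by (intro computable_foldr_list computable_intros l computable_app2'[where h=F, OF F])
qed

lemma computable_concat_map [computable_intros]:
  assumes F: "computable_fun (\<lambda>z. F (pfst z) (psnd z))" and l: "computable_fun l"
  shows "computable_fun (\<lambda>x. list_encode (concat (map (\<lambda>t. list_decode (F x t)) (list_decode (l x)))))"
proof -
  have *: "list_encode (concat (map (\<lambda>t. list_decode (F x t)) xs))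
      = foldr (\<lambda>t s. list_encode (list_decode (F x t) @ list_decode s)) xs 0" for x xs
  proof (induction xs)
    case (Cons a xs) show ?case by (simp flip: Cons)
  qed simp
  show ?thesis unfolding *
    by (intro computable_foldr_list computable_intros l computable_app2'[where h=F, OF F])
qed

section \<open>Elementary facts on C*-algebras\<close>

lemma scaleC_1 [simp]: "scaleC 1 (x::'a::unital_cstar_algebra) = x"
  using scaleR_scaleC[of 1 x] by simp

lemma scaleC_of_real [simp]: "scaleC (complex_of_real r) (x::'a::unital_cstar_algebra) = r *\<^sub>R x"
  by (simp add: scaleR_scaleC)

lemma scaleC_0_left [simp]: "scaleC 0 (x::'a::unital_cstar_algebra) = 0"
  using scaleC_of_real[of 0 x] by simp

lemma scaleC_0_right [simp]: "scaleC c (0::'a::unital_cstar_algebra) = 0"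
  using scaleC_add_right[of c 0 0] by simp

lemma star_0 [simp]: "star (0::'a::unital_cstar_algebra) = 0"
  using star_add[of 0 "0::'a"] by simp

lemma star_1 [simp]: "star (1::'a::unital_cstar_algebra) = 1"
  using star_mult[of 1 "star (1::'a)"] star_star[of "1::'a"] by simp

lemma star_minus [simp]: "star (- x) = - star (x::'a::unital_cstar_algebra)"
  using star_add[of x "-x"] by (simp add: eq_neg_iff_add_eq_0 add.commute)

lemma star_diff: "star (x - y) = star x - star (y::'a::unital_cstar_algebra)"
  using star_add[of x "-y"] by simp

lemma star_scaleR [simp]: "star (r *\<^sub>R x) = r *\<^sub>R star (x::'a::unital_cstar_algebra)"
  by (simp only: scaleR_scaleC star_scaleC complex_cnj_complex_of_real)

lemma norm_star [simp]: "norm (star x) = norm (x::'a::unital_cstar_algebra)"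
proof -
  have le: "norm y \<le> norm (star y)" for y :: 'a
  proof (cases "y = 0")
    case False
    have "norm y * norm y \<le> norm (star y) * norm y"
      using norm_mult_ineq[of "star y" y] by (simp add: cstar_identity power2_eq_square)
    with False show ?thesis by simp
  qed auto
  from le[of x] le[of "star x"] show ?thesis by (simp add: star_star)
qed

lemma tendsto_star [tendsto_intros]:
  fixes f :: "'c \<Rightarrow> 'a::unital_cstar_algebra"
  assumes "(f \<longlongrightarrow> l) F" shows "((\<lambda>x. star (f x)) \<longlongrightarrow> star l) F"
  using assms by (simp add: tendsto_iff dist_norm flip: star_diff)

lemma tendsto_scaleC_right [tendsto_intros]:
  fixes f :: "'c \<Rightarrow> 'a::unital_cstar_algebra"
  assumes "(f \<longlongrightarrow> l) F" shows "((\<lambda>x. scaleC c (f x)) \<longlongrightarrow> scaleC c l) F"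
proof -
  have *: "scaleC c (f x) - scaleC c l = scaleC c (f x - l)" for x
    using scaleC_add_right[of c "f x - l" l] by simp
  have "((\<lambda>x. norm (scaleC c (f x) - scaleC c l)) \<longlongrightarrow> cmod c * 0) F"
    unfolding * norm_scaleC
    by (intro tendsto_mult tendsto_const tendsto_norm_zero) (simp add: LIM_zero assms)
  then show ?thesis by (simp add: LIM_zero_iff tendsto_norm_zero_iff)
qed

lemma tendsto_scaleC_left [tendsto_intros]:
  fixes x :: "'a::unital_cstar_algebra"
  assumes "(f \<longlongrightarrow> c) F" shows "((\<lambda>i. scaleC (f i) x) \<longlongrightarrow> scaleC c x) F"
proof -
  have *: "scaleC (f i) x - scaleC c x = scaleC (f i - c) x" for i
    using scaleC_add_left[of "f i - c" c x] by simp
  have "((\<lambda>i. norm (scaleC (f i) x - scaleC c x)) \<longlongrightarrow> 0 * norm x) F"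
    unfolding * norm_scaleC
    by (intro tendsto_mult tendsto_const tendsto_norm_zero) (simp add: LIM_zero assms)
  then show ?thesis by (simp add: LIM_zero_iff tendsto_norm_zero_iff)
qed

lemma norm_one_le: "norm (1::'a::unital_cstar_algebra) \<le> 1"
  using cstar_identity[of "1::'a"] by (auto simp: power2_eq_square)

lemma unitary_norm_le:
  fixes u :: "'a::unital_cstar_algebra"
  assumes "star u * u = 1" shows "norm u \<le> 1"
proof -
  have "(norm u)\<^sup>2 \<le> 1" using cstar_identity[of u] assms norm_one_le[where 'a='a] by simp
  then show ?thesis by (simp add: power2_le_iff_abs_le abs_le_square_iff power_le_one_iff abs_square_le_1)
qed

lemma norm_mult_le2:
  fixes x y :: "'a::real_normed_algebra"
  assumes "norm x \<le> r" "norm y \<le> s" shows "norm (x * y) \<le> r * s"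
  by (meson assms mult_mono' norm_ge_zero norm_mult_ineq order_trans)

text \<open>
  Newton's iteration and the intertwining both converge geometrically, the latter only from the stage
  \<open>N\<close> on from which an element is tracked.
\<close>

lemma geometric_tail_limit:
  fixes s :: "nat \<Rightarrow> 'a::banach"
  assumes step: "\<And>k. k \<ge> N \<Longrightarrow> norm (s (Suc k) - s k) \<le> C / 2 ^ k"
  shows "\<exists>L. s \<longlonglongrightarrow> L \<and> (\<forall>k\<ge>N. norm (L - s k) \<le> 2 * C / 2 ^ k)"
proof -
  have C: "C \<ge> 0"
  proof -
    have "0 \<le> C / 2 ^ N" by (rule order_trans[OF norm_ge_zero step]) simp
    then have "0 \<le> C / 2 ^ N * 2 ^ N" by (intro mult_nonneg_nonneg) auto
    then show ?thesis by simp
  qed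
  have tail: "norm (s (k + m) - s k) \<le> 2 * C / 2 ^ k * (1 - 1 / 2 ^ m)" if "k \<ge> N" for k m
  proof (induction m)
    case (Suc m)
    have "norm (s (k + Suc m) - s k) \<le> norm (s (Suc (k + m)) - s (k + m)) + norm (s (k + m) - s k)"
      using norm_triangle_ineq[of "s (Suc (k + m)) - s (k + m)" "s (k + m) - s k"] by simp
    also have "\<dots> \<le> C / 2 ^ (k + m) + 2 * C / 2 ^ k * (1 - 1 / 2 ^ m)"
      using step[of "k + m"] that Suc by simp
    also have "\<dots> = 2 * C / 2 ^ k * (1 - 1 / 2 ^ Suc m)"
      by (simp add: field_simps power_add)
    finally show ?case .
  qed simp
  have tail': "norm (s (k + m) - s k) \<le> 2 * C / 2 ^ k" if "k \<ge> N" for k m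
  proof -
    have "2 * C / 2 ^ k * (1 - 1 / 2 ^ m) \<le> 2 * C / 2 ^ k * 1"
      using C by (intro mult_left_mono) auto
    with tail[OF that, of m] show ?thesis by simp
  qed
  have "Cauchy s"
  proof (rule CauchyI)
    fix e :: real assume "e > 0"
    have "(\<lambda>k. 4 * C / 2 ^ k) \<longlonglongrightarrow> 0"
      by (intro LIMSEQ_divide_realpow_zero) simp
    then have "\<forall>\<^sub>F k in sequentially. 4 * C / 2 ^ k < e"
      using \<open>e > 0\<close> by (rule order_tendstoD)
    then obtain K where K: "\<And>k. k \<ge> K \<Longrightarrow> 4 * C / 2 ^ k < e" by (auto simp: eventually_sequentially)
    define k where "k = max K N"
    have "norm (s m - s n) < e" if "m \<ge> k" "n \<ge> k" for m n
    proof -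
      have "norm (s m - s k) \<le> 2 * C / 2 ^ k" "norm (s n - s k) \<le> 2 * C / 2 ^ k"
        using tail'[of k "m - k"] tail'[of k "n - k"] that by (auto simp: k_def)
      then have "norm (s m - s n) \<le> 4 * C / 2 ^ k"
        using norm_triangle_ineq4[of "s m - s k" "s n - s k"] by simp
      then show ?thesis using K[of k] by (simp add: k_def)
    qed
    then show "\<exists>M. \<forall>m\<ge>M. \<forall>n\<ge>M. norm (s m - s n) < e" by blast
  qed
  then obtain L where L: "s \<longlonglongrightarrow> L" by (auto simp: Cauchy_convergent_iff convergent_def)
  have "norm (L - s k) \<le> 2 * C / 2 ^ k" if "k \<ge> N" for k
  proof (rule tendsto_upperbound)
    show "(\<lambda>m. norm (s (k + m) - s k)) \<longlonglongrightarrow> norm (L - s k)"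
      using LIMSEQ_ignore_initial_segment[OF L, of k]
      by (intro tendsto_intros) (simp add: add.commute)
  qed (use tail'[OF that] in auto)
  with L show ?thesis by blast
qed

section \<open>Square roots and isometry\<close>

text \<open>
  A solution of \<open>(1 - y)\<^sup>2 = 1 - a\<close> is a fixed point of \<open>y \<mapsto> (a + y\<^sup>2) / 2\<close>. Iterating from \<open>0\<close> produces
  polynomials in \<open>a\<close>. The same iteration for the scalar \<open>a = 1\<close> is increasing and bounded by \<open>1\<close>, and its
  increments dominate those in the algebra; this gives convergence even for \<open>\<parallel>a\<parallel> = 1\<close>, where the map is
  no longer a contraction.
\<close>

lemma sqrt_one_minus:
  fixes a :: "'a::unital_cstar_algebra"
  assumes a: "norm a \<le> 1" and sa: "star a = a"
  obtains y where "norm y \<le> 1" "star y = y" "\<And>z. z * a = a * z \<Longrightarrow> z * y = y * z"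
    "(1 - y) * (1 - y) = 1 - a"
proof -
  define Y :: "nat \<Rightarrow> 'a" where "Y = rec_nat 0 (\<lambda>_ y. (1/2) *\<^sub>R (a + y * y))"
  define t :: "nat \<Rightarrow> real" where "t = rec_nat 0 (\<lambda>_ y. (1/2) * (1 + y * y))"
  have Y0: "Y 0 = 0" and YS: "Y (Suc n) = (1/2) *\<^sub>R (a + Y n * Y n)" for n by (auto simp: Y_def)
  have t0: "t 0 = 0" and tS: "t (Suc n) = (1/2) * (1 + t n * t n)" for n by (auto simp: t_def)
  have t_bd: "0 \<le> t n \<and> t n \<le> 1" for n
  proof (induction n)
    case (Suc n)
    then have "t n * t n \<le> 1 * 1" by (intro mult_mono) auto
    then show ?case by (simp add: tS)
  qed (simp add: t0)
  have norm_Y: "norm (Y n) \<le> t n" for n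
  proof (induction n)
    case (Suc n)
    have "norm (a + Y n * Y n) \<le> 1 + t n * t n"
      by (rule norm_triangle_le) (intro add_mono a norm_mult_le2 Suc)
    then show ?case by (simp add: YS tS)
  qed (simp add: Y0 t0)
  have diff_Y: "norm (Y (Suc n) - Y n) \<le> t (Suc n) - t n" for n
  proof (induction n)
    case 0 then show ?case using a by (simp add: Y0 YS t0 tS)
  next
    case (Suc n)
    have "Y (Suc (Suc n)) - Y (Suc n)
        = (1/2) *\<^sub>R (Y (Suc n) * (Y (Suc n) - Y n) + (Y (Suc n) - Y n) * Y n)"
      unfolding YS[of "Suc n"] YS[of n] by (simp add: algebra_simps)
    also have "norm \<dots> \<le> (1/2) * (t (Suc n) * (t (Suc n) - t n) + (t (Suc n) - t n) * t n)"
      unfolding norm_scaleR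
      by (intro mult_mono norm_triangle_le add_mono norm_mult_le2 norm_Y Suc) auto
    also have "\<dots> = t (Suc (Suc n)) - t (Suc n)"
      unfolding tS[of "Suc n"] tS[of n] by (simp add: algebra_simps)
    finally show ?case .
  qed
  have "summable (\<lambda>n. t (Suc n) - t n)"
  proof -
    have "incseq t"
      using diff_Y by (intro incseq_SucI) (meson diff_ge_0_iff_ge norm_ge_zero order_trans)
    then have "convergent t"
      using t_bd by (meson incseq_convergent convergentI)
    then show ?thesis
      by (auto simp: convergent_def dest: telescope_summable)
  qed
  then have "summable (\<lambda>n. Y (Suc n) - Y n)"
    by (rule summable_comparison_test') (use diff_Y in auto)
  then have "convergent Y"
  proof -
    have "(\<lambda>n. \<Sum>i<n. Y (Suc i) - Y i) = Y"
      by (simp add: sum_lessThan_telescope Y0 fun_eq_iff)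
    with \<open>summable (\<lambda>n. Y (Suc n) - Y n)\<close> show ?thesis by (simp add: summable_iff_convergent)
  qed
  then obtain y where y: "Y \<longlonglongrightarrow> y" by (auto simp: convergent_def)
  have eq: "y = (1/2) *\<^sub>R (a + y * y)"
  proof (rule LIMSEQ_unique)
    show "(\<lambda>n. Y (Suc n)) \<longlonglongrightarrow> y" using y by (rule LIMSEQ_Suc)
    show "(\<lambda>n. Y (Suc n)) \<longlonglongrightarrow> (1/2) *\<^sub>R (a + y * y)" unfolding YS by (intro tendsto_intros y)
  qed
  show ?thesis
  proof
    show "norm y \<le> 1"
      by (rule tendsto_upperbound[OF tendsto_norm[OF y]])
        (use norm_Y t_bd in \<open>auto intro!: always_eventually order_trans[OF norm_Y]\<close>)
    have "star (Y n) = Y n" for n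
      by (induction n) (auto simp: Y0 YS star_add star_mult sa)
    then have "Y \<longlonglongrightarrow> star y" using tendsto_star[OF y] by simp
    then show "star y = y" using y LIMSEQ_unique by blast
    show "z * y = y * z" if z: "z * a = a * z" for z
    proof -
      have *: "z * Y n = Y n * z" for n
      proof (induction n)
        case (Suc n)
        have "z * (Y n * Y n) = Y n * Y n * z" using Suc by (metis mult.assoc)
        then show ?case using z by (simp add: YS distrib_left distrib_right)
      qed (simp add: Y0)
      show ?thesis
        by (rule LIMSEQ_unique[of "\<lambda>n. z * Y n"])
          (use tendsto_mult_left[OF y, of z] tendsto_mult_right[OF y, of z] * in auto)
    qed
    have "y + y = a + y * y" using eq by (metis scaleR_2 scaleR_scaleR scaleR_one nonzero_mult_div_cancel_left times_divide_eq_right zero_neq_numeral)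
    then show "(1 - y) * (1 - y) = 1 - a" by (simp add: algebra_simps)
  qed
qed


text \<open>
  The element \<open>h + i k\<close> is unitary and \<open>h\<close> is its real part. This replaces the positivity argument
  \<open>h\<^sup>2 \<le> h\<^sup>2 + k\<^sup>2 = 1\<close>.
\<close>

lemma norm_le_1_if_sum_squares:
  fixes h k :: "'a::unital_cstar_algebra"
  assumes h: "star h = h" and k: "star k = k" and comm: "h * k = k * h"
    and one: "h * h + k * k = 1"
  shows "norm h \<le> 1"
proof -
  define u where "u = h + scaleC \<i> k"
  have su: "star u = h + scaleC (- \<i>) k"
    by (simp add: u_def star_add star_scaleC h k)
  have "star u * u = h * h + k * k"
    unfolding su unfolding u_def
    by (simp add: algebra_simps mult_scaleC_left' mult_scaleC_right' scaleC_scaleC comm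
        scaleC_add_right) (simp add: add.assoc[symmetric] flip: scaleC_add_left)
  then have u: "norm u \<le> 1" using one by (intro unitary_norm_le) simp
  have "u + star u = h + h"
    unfolding su unfolding u_def by (simp add: algebra_simps flip: scaleC_add_left)
  then have "2 *\<^sub>R h = u + star u" by (simp add: scaleR_2)
  then have "2 * norm h \<le> norm u + norm (star u)"
    using norm_triangle_ineq[of u "star u"] by (metis norm_scaleR abs_numeral)
  with u show ?thesis by simp
qed

context
  fixes \<phi> :: "'a::unital_cstar_algebra \<Rightarrow> 'b::unital_cstar_algebra"
  assumes hom: "star_hom \<phi>"
begin

lemma star_hom_simps:
  shows star_hom_add: "\<phi> (x + y) = \<phi> x + \<phi> y"
    and star_hom_scaleC: "\<phi> (scaleC c x) = scaleC c (\<phi> x)"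
    and star_hom_scaleR: "\<phi> (r *\<^sub>R x) = r *\<^sub>R \<phi> x"
    and star_hom_mult: "\<phi> (x * y) = \<phi> x * \<phi> y"
    and star_hom_star: "\<phi> (star x) = star (\<phi> x)"
    and star_hom_one: "\<phi> 1 = 1"
    and star_hom_zero: "\<phi> 0 = 0"
    and star_hom_minus: "\<phi> (- x) = - \<phi> x"
    and star_hom_diff: "\<phi> (x - y) = \<phi> x - \<phi> y"
proof -
  show add: "\<phi> (x + y) = \<phi> x + \<phi> y" for x y using hom by (simp add: star_hom_def)
  show "\<phi> (scaleC c x) = scaleC c (\<phi> x)" using hom by (simp add: star_hom_def)
  show "\<phi> (r *\<^sub>R x) = r *\<^sub>R \<phi> x" using hom by (simp only: star_hom_def scaleR_scaleC)
  show "\<phi> (x * y) = \<phi> x * \<phi> y" using hom by (simp add: star_hom_def)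
  show "\<phi> (star x) = star (\<phi> x)" using hom by (simp add: star_hom_def)
  show "\<phi> 1 = 1" using hom by (simp add: star_hom_def)
  show 0: "\<phi> 0 = 0" using add[of 0 0] by simp
  show minus: "\<phi> (- x) = - \<phi> x" for x
    using add[of x "- x"] 0 by (simp add: eq_neg_iff_add_eq_0 add.commute)
  show "\<phi> (x - y) = \<phi> x - \<phi> y" using add[of x "- y"] minus[of y] by simp
qed

text \<open>
  By the C*-identity it suffices to treat self-adjoint \<open>h\<close> with \<open>\<parallel>h\<parallel> \<le> 1\<close>. There is a self-adjoint \<open>k\<close>
  commuting with \<open>h\<close> such that \<open>h\<^sup>2 + k\<^sup>2 = 1\<close>, and this relation is inherited by the images.
\<close>

lemma star_hom_norm_le: "norm (\<phi> x) \<le> norm x"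
proof -
  have unit: "norm (\<phi> h) \<le> 1" if h: "star h = h" and n: "norm h \<le> 1" for h
  proof -
    have "norm (h * h) \<le> 1" using norm_mult_le2[OF n n] by simp
    moreover have "star (h * h) = h * h" by (simp add: star_mult h)
    ultimately obtain y where y: "star y = y" "\<And>z. z * (h * h) = h * h * z \<Longrightarrow> z * y = y * z"
      "(1 - y) * (1 - y) = 1 - h * h" using sqrt_one_minus by metis
    have comm: "h * y = y * h" by (rule y(2)) (simp add: mult.assoc)
    have "\<phi> h * \<phi> h + \<phi> (1 - y) * \<phi> (1 - y) = \<phi> (h * h + (1 - y) * (1 - y))"
      by (simp only: star_hom_simps)
    also have "\<dots> = 1" by (simp add: y star_hom_one)
    finally have "\<phi> h * \<phi> h + \<phi> (1 - y) * \<phi> (1 - y) = 1" .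
    moreover have "\<phi> h * \<phi> (1 - y) = \<phi> (1 - y) * \<phi> h"
      using comm by (simp add: algebra_simps flip: star_hom_mult)
    ultimately show ?thesis
      by (intro norm_le_1_if_sum_squares[of "\<phi> h" "\<phi> (1 - y)"])
         (simp_all add: h y star_diff flip: star_hom_star)
  qed
  show ?thesis
  proof (cases "x = 0")
    case False
    define h where "h = (1 / (norm x)\<^sup>2) *\<^sub>R (star x * x)"
    have "norm (\<phi> h) \<le> 1"
      by (rule unit) (use False in \<open>simp_all add: h_def star_mult star_star cstar_identity\<close>)
    then have "(norm (\<phi> x))\<^sup>2 \<le> (norm x)\<^sup>2"
      using False by (simp add: h_def star_hom_simps cstar_identity field_simps)
    then show ?thesis by simp
  qed (simp add: star_hom_zero)
qed

text \<open>
  If \<open>\<phi>\<close> decreased the norm of some element, then, passing to a high power of the normalized \<open>x\<^sup>* x\<close>, there would be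
  \<open>h = g\<^sup>2\<close> of norm \<open>1\<close> with \<open>\<parallel>\<phi> h\<parallel> \<le> 1/4\<close>. The function \<open>t \<mapsto> max (t - 1/2) 0\<close> vanishes at \<open>\<phi> h\<close> but not at
  \<open>h\<close>, contradicting injectivity. For \<open>c = (h - 1/2) / 2\<close> the value of this function at \<open>h\<close> is
  \<open>\<bar>c\<bar> + c\<close>, and only the absolute value \<open>\<bar>c\<bar> = \<surd>(c\<^sup>2)\<close> has to be constructed.
\<close>

lemma inj_star_hom_norm_eq:
  assumes inj: "inj \<phi>"
  shows "norm (\<phi> x) = norm x"
proof (rule ccontr)
  assume "norm (\<phi> x) \<noteq> norm x"
  with star_hom_norm_le have less: "norm (\<phi> x) < norm x" by (metis order_le_less)
  define h0 where "h0 = (1 / (norm x)\<^sup>2) *\<^sub>R (star x * x)"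
  have nx: "norm x > 0" using less by (meson norm_ge_zero order_le_less_trans)
  have h0: "star h0 = h0" "norm h0 = 1"
    using nx by (simp_all add: h0_def star_mult star_star cstar_identity)
  have phi_h0: "norm (\<phi> h0) < 1"
    using less nx by (simp add: h0_def star_hom_simps cstar_identity field_simps power_strict_mono)
  \<comment> \<open>The norm of a self-adjoint element is squared exactly when the element is squared.\<close>
  define H where "H = rec_nat h0 (\<lambda>_ h. h * h)"
  have H0: "H 0 = h0" and HS: "H (Suc n) = H n * H n" for n by (auto simp: H_def)
  have sH: "star (H n) = H n" for n by (induction n) (simp_all add: H0 HS h0 star_mult)
  have nH: "norm (H n) = 1" for n
  proof (induction n)
    case (Suc n)
    then show ?case using cstar_identity[of "H n"] by (simp add: HS sH)
  qed (simp add: H0 h0)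
  have phi_H: "norm (\<phi> (H n)) \<le> norm (\<phi> h0) ^ (2 ^ n)" for n
  proof (induction n)
    case (Suc n)
    show ?case using norm_mult_le2[OF Suc Suc] by (simp add: HS star_hom_mult mult_2 power_add)
  qed (simp add: H0)
  have "(\<lambda>n. norm (\<phi> h0) ^ n) \<longlonglongrightarrow> 0" using phi_h0 by (intro LIMSEQ_power_zero) simp
  then have "\<forall>\<^sub>F n in sequentially. norm (\<phi> h0) ^ n < 1/4" by (rule order_tendstoD) simp
  then obtain N where N: "\<And>n. n \<ge> N \<Longrightarrow> norm (\<phi> h0) ^ n < 1/4" by (auto simp: eventually_sequentially)
  define g where "g = H N"
  define h where "h = g * g"
  have "N \<le> 2 ^ Suc N" using less_exp[of "Suc N"] by linarith
  then have phi_h: "norm (\<phi> h) \<le> 1/4"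
    using phi_H[of "Suc N"] N[of "2 ^ Suc N"] by (simp add: h_def g_def HS)
  have g: "star g = g" and h: "star h = h" "norm h = 1"
    using sH[of N] sH[of "Suc N"] nH[of "Suc N"] by (simp_all add: g_def h_def HS)
  have nc1: "norm (h - (1/2) *\<^sub>R 1) \<le> 1 + 1/2"
    using norm_triangle_ineq4[of h "(1/2) *\<^sub>R 1"] h(2) norm_one_le[where 'a='a] by simp
  define c where "c = (1/2) *\<^sub>R (h - (1/2) *\<^sub>R 1)"
  have sc: "star c = c" by (simp add: c_def star_diff h)
  have nc: "norm c \<le> 1"
    using nc1 by (simp add: c_def)
  \<comment> \<open>The absolute value of \<open>c\<close> is \<open>1 - y\<close>, a root of \<open>1 - (1 - c\<^sup>2)\<close>.\<close>
  have "norm (1 - c * c) \<le> 1"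
  proof -
    have "norm (c * c) \<le> 1" using norm_mult_le2[OF nc nc] by simp
    moreover have "star (c * c) = c * c" by (simp add: star_mult sc)
    ultimately obtain y where y: "star y = y" "\<And>z. z * (c * c) = c * c * z \<Longrightarrow> z * y = y * z"
      "(1 - y) * (1 - y) = 1 - c * c" using sqrt_one_minus by metis
    have "c * y = y * c" by (rule y(2)) (simp add: mult.assoc)
    then have "norm (1 - y) \<le> 1"
      by (intro norm_le_1_if_sum_squares[of "1 - y" c])
        (simp add: y star_diff, simp add: sc, simp add: algebra_simps, simp add: y(3))
    then show ?thesis using norm_mult_le2[of "1 - y" 1 "1 - y" 1] by (simp add: y)
  qed
  moreover have "star (1 - c * c) = 1 - c * c" by (simp add: star_mult star_diff sc)
  ultimately obtain y where y: "norm y \<le> 1" "star y = y"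
    "\<And>z. z * (1 - c * c) = (1 - c * c) * z \<Longrightarrow> z * y = y * z"
    "(1 - y) * (1 - y) = c * c" using sqrt_one_minus[of "1 - c * c"] by force
  have cy: "c * y = y * c" by (rule y(3)) (simp add: algebra_simps mult.assoc)
  \<comment> \<open>With \<open>q = \<phi> \<bar>c\<bar> + \<phi> c\<close> and \<open>\<phi> \<bar>c\<bar> - \<phi> c = 5/4 - r\<close>, the product of the two vanishes and the
    second factor is invertible because of \<open>\<parallel>r\<parallel> < 5/4\<close>.\<close>
  define q where "q = \<phi> (1 - y) + \<phi> c"
  define r where "r = \<phi> y + (1/2) *\<^sub>R \<phi> h"
  have pd: "\<phi> (1 - y) - \<phi> c = (5/4) *\<^sub>R 1 - r"
  proof -
    have "(5/4) *\<^sub>R 1 = 1 + (1/4) *\<^sub>R (1::'b)" using scaleR_left_distrib[of 1 "1/4" "1::'b"] by simp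
    then show ?thesis by (simp add: r_def c_def star_hom_simps scaleR_diff_right)
  qed
  have "q * (\<phi> (1 - y) - \<phi> c) = \<phi> ((1 - y + c) * (1 - y - c))"
    by (simp add: q_def flip: star_hom_simps)
  also have "(1 - y + c) * (1 - y - c) = (1 - y) * (1 - y) - c * c"
    using cy by (simp add: algebra_simps)
  finally have "q * (\<phi> (1 - y) - \<phi> c) = 0" by (simp add: y star_hom_zero)
  then have qr: "(5/4) *\<^sub>R q = q * r" unfolding pd by (simp add: algebra_simps)
  have "norm r \<le> 1 + 1/8"
    unfolding r_def using star_hom_norm_le[of y] y(1) phi_h by (intro norm_triangle_le) simp
  then have "norm (q * r) \<le> norm q * (9/8)" by (intro norm_mult_le2) auto
  moreover have "5/4 * norm q = norm (q * r)" using arg_cong[OF qr, of norm] by simp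
  ultimately have "norm q \<le> 0" by linarith
  then have "q = 0" by simp
  then have "\<phi> (1 - y + c) = \<phi> 0" by (simp add: q_def star_hom_simps)
  then have "1 - y + c = 0" using inj by (simp add: inj_eq)
  then have yh: "y = (3/4) *\<^sub>R 1 + (1/2) *\<^sub>R h"
  proof -
    have "(3/4) *\<^sub>R 1 = 1 - (1/4) *\<^sub>R (1::'a)" using scaleR_left_diff_distrib[of 1 "1/4" "1::'a"] by simp
    moreover have "y = 1 + c" using \<open>1 - y + c = 0\<close> by (simp add: algebra_simps)
    ultimately show ?thesis by (simp add: c_def scaleR_diff_right)
  qed
  \<comment> \<open>Now \<open>\<bar>c\<bar> = - c\<close>, so \<open>1/4 - h/2 = 1 - y\<close> is a square \<open>(1 - m)\<^sup>2\<close>, whence \<open>2 g\<^sup>2 + (2 (1 - m))\<^sup>2 = 1\<close> and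
    \<open>\<parallel>g\<^sup>2\<parallel> \<le> 1/2\<close>.\<close>
  obtain m where m: "star m = m" "\<And>z. z * y = y * z \<Longrightarrow> z * m = m * z"
    "(1 - m) * (1 - m) = 1 - y" using sqrt_one_minus[OF y(1,2)] by metis
  have "g * y = y * g" by (simp add: yh h_def algebra_simps mult.assoc)
  then have gm: "g * m = m * g" by (rule m(2))
  have "norm (sqrt 2 *\<^sub>R g) \<le> 1"
  proof (rule norm_le_1_if_sum_squares[of _ "2 *\<^sub>R (1 - m)"])
    have "(sqrt 2 *\<^sub>R g) * (sqrt 2 *\<^sub>R g) + (2 *\<^sub>R (1 - m)) * (2 *\<^sub>R (1 - m))
        = 2 *\<^sub>R h + 4 *\<^sub>R (1 - y)" by (simp add: h_def m(3))
    also have "\<dots> = 4 *\<^sub>R 1 - 3 *\<^sub>R 1" by (simp add: yh scaleR_diff_right scaleR_add_right)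
    also have "\<dots> = 1" by (simp flip: scaleR_left_diff_distrib)
    finally show "(sqrt 2 *\<^sub>R g) * (sqrt 2 *\<^sub>R g) + (2 *\<^sub>R (1 - m)) * (2 *\<^sub>R (1 - m)) = 1" .
  qed (simp_all add: g m star_diff left_diff_distrib right_diff_distrib gm scaleR_diff_right mult.commute)
  then have "norm ((sqrt 2 *\<^sub>R g) * (sqrt 2 *\<^sub>R g)) \<le> 1 * 1" by (intro norm_mult_le2)
  then show False using h(2) by (simp add: h_def)
qed

end

section \<open>Arithmetic on codes of rational points\<close>

text \<open>
  Integers are handled as differences of natural numbers, so that the arithmetic on their codes reduces
  to natural numbers.
\<close>

definition diff_code :: "nat \<Rightarrow> nat \<Rightarrow> nat" where
  "diff_code p q = (if q \<le> p then 2 * (p - q) else 2 * (q - p) - 1)"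

definition int_pos :: "nat \<Rightarrow> nat" where "int_pos n = (if even n then n div 2 else 0)"
definition int_neg :: "nat \<Rightarrow> nat" where "int_neg n = (if even n then 0 else Suc n div 2)"

lemma int_decode_eq_diff: "int_decode n = int (int_pos n) - int (int_neg n)"
  by (auto simp: int_decode_def sum_decode_def int_pos_def int_neg_def elim!: oddE)

lemma int_decode_diff_code: "int_decode (diff_code p q) = int p - int q"
proof -
  have "odd (2 * (q - p) - 1)" "2 * (q - p) - 1 + 1 = 2 * (q - p)" if "p < q"
    using that by auto
  then show ?thesis by (auto simp: int_decode_eq_diff int_pos_def int_neg_def diff_code_def)
qed

definition rat_add_code :: "nat \<Rightarrow> nat \<Rightarrow> nat" where
  "rat_add_code m n = prod_encode
     (diff_code (int_pos (pfst m) * Suc (psnd n) + int_pos (pfst n) * Suc (psnd m))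
                (int_neg (pfst m) * Suc (psnd n) + int_neg (pfst n) * Suc (psnd m)),
      Suc (psnd m) * Suc (psnd n) - 1)"

definition rat_mult_code :: "nat \<Rightarrow> nat \<Rightarrow> nat" where
  "rat_mult_code m n = prod_encode
     (diff_code (int_pos (pfst m) * int_pos (pfst n) + int_neg (pfst m) * int_neg (pfst n))
                (int_pos (pfst m) * int_neg (pfst n) + int_neg (pfst m) * int_pos (pfst n)),
      Suc (psnd m) * Suc (psnd n) - 1)"

definition rat_minus_code :: "nat \<Rightarrow> nat" where
  "rat_minus_code n = prod_encode (diff_code (int_neg (pfst n)) (int_pos (pfst n)), psnd n)"

lemma rat_of_code_eq:
  "rat_of_code n = (of_nat (int_pos (pfst n)) - of_nat (int_neg (pfst n))) / of_nat (Suc (psnd n))"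
  by (simp add: rat_of_code_def int_decode_eq_diff split: prod.splits)

lemma rat_of_code_pair: "rat_of_code (prod_encode (i, d)) = of_int (int_decode i) / of_nat (Suc d)"
  by (simp add: rat_of_code_def)

lemma rat_of_code_add: "rat_of_code (rat_add_code m n) = rat_of_code m + rat_of_code n"
  unfolding rat_add_code_def rat_of_code_pair int_decode_diff_code unfolding rat_of_code_eq
  by (simp add: divide_simps del: of_nat_Suc) (simp add: algebra_simps)

lemma rat_of_code_mult: "rat_of_code (rat_mult_code m n) = rat_of_code m * rat_of_code n"
  unfolding rat_mult_code_def rat_of_code_pair int_decode_diff_code unfolding rat_of_code_eq
  by (simp add: divide_simps del: of_nat_Suc) (simp add: algebra_simps)

lemma rat_of_code_minus: "rat_of_code (rat_minus_code n) = - rat_of_code n"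
  unfolding rat_minus_code_def rat_of_code_pair int_decode_diff_code unfolding rat_of_code_eq
  by (simp add: divide_simps)

definition coeff_val :: "nat \<Rightarrow> complex" where
  "coeff_val c = Complex (of_rat (rat_of_code (pfst c))) (of_rat (rat_of_code (psnd c)))"

definition coeff_mult_code :: "nat \<Rightarrow> nat \<Rightarrow> nat" where
  "coeff_mult_code c d = prod_encode
     (rat_add_code (rat_mult_code (pfst c) (pfst d)) (rat_minus_code (rat_mult_code (psnd c) (psnd d))),
      rat_add_code (rat_mult_code (pfst c) (psnd d)) (rat_mult_code (psnd c) (pfst d)))"

definition coeff_cnj_code :: "nat \<Rightarrow> nat" where
  "coeff_cnj_code c = prod_encode (pfst c, rat_minus_code (psnd c))"

definition real_coeff_code :: "int \<Rightarrow> nat \<Rightarrow> nat" where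
  "real_coeff_code p d = prod_encode (prod_encode (int_encode p, d), prod_encode (int_encode 0, 0))"

lemma coeff_val_mult: "coeff_val (coeff_mult_code c d) = coeff_val c * coeff_val d"
  by (simp add: coeff_val_def coeff_mult_code_def rat_of_code_add rat_of_code_mult
      rat_of_code_minus of_rat_add of_rat_diff of_rat_mult of_rat_minus complex_eq_iff)

lemma coeff_val_cnj: "coeff_val (coeff_cnj_code c) = cnj (coeff_val c)"
  by (simp add: coeff_val_def coeff_cnj_code_def rat_of_code_minus of_rat_minus complex_eq_iff)

lemma coeff_val_real: "coeff_val (real_coeff_code p d) = of_real (real_of_int p / real (Suc d))"
  by (simp add: coeff_val_def real_coeff_code_def rat_of_code_pair of_rat_divide complex_eq_iff
      del: of_nat_Suc)

text \<open>
  If constant terms are excluded, the codes of words are shifted by one in order to skip the empty word.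
  Operations on words are therefore performed on the lists of letters and shifted back.
\<close>

definition letters :: "bool \<Rightarrow> nat \<Rightarrow> nat list" where
  "letters ct n = list_decode (if ct then n else Suc n)"

definition letters_code :: "bool \<Rightarrow> nat list \<Rightarrow> nat" where
  "letters_code ct xs = (if ct then list_encode xs else list_encode xs - 1)"

lemma letters_code_inverse:
  assumes "ct \<or> xs \<noteq> []" shows "letters ct (letters_code ct xs) = xs"
proof -
  have "Suc (list_encode xs - 1) = list_encode xs" if "xs \<noteq> []" using that by (cases xs) auto
  then show ?thesis using assms
    by (cases ct) (simp_all add: letters_def letters_code_def del: list_decode.simps)
qed

lemma letters_nonempty: "\<not> ct \<Longrightarrow> letters ct n \<noteq> []"
  by (simp add: letters_def split: prod.splits)

definition word_val :: "bool \<Rightarrow> (nat \<Rightarrow> 'a::unital_cstar_algebra) \<Rightarrow> nat \<Rightarrow> 'a" where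
  "word_val ct a n = eval_word a (word_of_code ct n)"

lemma word_val_eq: "word_val ct a n = eval_word a (map letter_of_code (letters ct n))"
  by (simp add: word_val_def word_of_code_def letters_def)

lemma eval_word_append: "eval_word a (v @ w) = eval_word a v * eval_word a w"
  by (simp add: eval_word_def)

text \<open>
  The letters with codes \<open>2 i\<close> and \<open>2 i + 1\<close> are adjoint to each other.
\<close>

definition flip_letter :: "nat \<Rightarrow> nat" where
  "flip_letter l = (if even l then Suc l else l - 1)"

lemma eval_word_star:
  "eval_word a (map letter_of_code (rev (map flip_letter xs))) = star (eval_word a (map letter_of_code xs))"
proof (induction xs)
  case (Cons x xs)
  have "eval_word a [letter_of_code (flip_letter x)] = star (eval_word a [letter_of_code x])"
    by (auto simp: eval_word_def letter_of_code_def flip_letter_def star_star elim!: oddE)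
  moreover have "eval_word a (map letter_of_code (x # xs))
      = eval_word a [letter_of_code x] * eval_word a (map letter_of_code xs)"
    by (simp add: eval_word_def)
  ultimately show ?case using Cons by (simp add: eval_word_append star_mult)
qed (simp add: eval_word_def)

definition word_mult_code :: "bool \<Rightarrow> nat \<Rightarrow> nat \<Rightarrow> nat" where
  "word_mult_code ct m n = letters_code ct (letters ct m @ letters ct n)"

text \<open>
  Encoding and decoding the intermediate list is redundant, but it presents the function as a
  composition of list operations on codes.
\<close>

definition word_star_code :: "bool \<Rightarrow> nat \<Rightarrow> nat" where
  "word_star_code ct n = letters_code ct (rev (list_decode (list_encode (map flip_letter (letters ct n)))))"

lemma word_val_mult: "word_val ct a (word_mult_code ct m n) = word_val ct a m * word_val ct a n"
  using letters_nonempty[of ct m]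
  by (cases ct) (simp_all add: word_val_eq word_mult_code_def letters_code_inverse eval_word_append)

lemma word_val_star: "word_val ct a (word_star_code ct n) = star (word_val ct a n)"
  using letters_nonempty[of ct n]
  by (cases ct) (simp_all add: word_val_eq word_star_code_def letters_code_inverse eval_word_star)

definition term_val :: "bool \<Rightarrow> (nat \<Rightarrow> 'a::unital_cstar_algebra) \<Rightarrow> nat \<Rightarrow> 'a" where
  "term_val ct a t = scaleC (coeff_val (pfst t)) (word_val ct a (psnd t))"

lemma rat_point_eq_sum_list: "rat_point ct a n = sum_list (map (term_val ct a) (list_decode n))"
  by (auto simp: rat_point_def eval_poly_def poly_of_code_def coeff_of_code_def term_val_def
      coeff_val_def word_val_def split: prod.splits intro!: arg_cong[where f=sum_list])

definition term_mult_code :: "bool \<Rightarrow> nat \<Rightarrow> nat \<Rightarrow> nat" where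
  "term_mult_code ct s t = prod_encode (coeff_mult_code (pfst s) (pfst t), word_mult_code ct (psnd s) (psnd t))"

definition term_scale_code :: "nat \<Rightarrow> nat \<Rightarrow> nat" where
  "term_scale_code c t = prod_encode (coeff_mult_code c (pfst t), psnd t)"

definition term_star_code :: "bool \<Rightarrow> nat \<Rightarrow> nat" where
  "term_star_code ct t = prod_encode (coeff_cnj_code (pfst t), word_star_code ct (psnd t))"

definition add_code :: "nat \<Rightarrow> nat \<Rightarrow> nat" where
  "add_code m n = list_encode (list_decode m @ list_decode n)"

definition mult_code :: "bool \<Rightarrow> nat \<Rightarrow> nat \<Rightarrow> nat" where
  "mult_code ct m n = list_encode (concat (map (\<lambda>s.
     list_decode (list_encode (map (term_mult_code ct s) (list_decode n)))) (list_decode m)))"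

definition scale_code :: "nat \<Rightarrow> nat \<Rightarrow> nat" where
  "scale_code c n = list_encode (map (term_scale_code c) (list_decode n))"

definition star_code :: "bool \<Rightarrow> nat \<Rightarrow> nat" where
  "star_code ct n = list_encode (map (term_star_code ct) (list_decode n))"

definition diff_point_code :: "nat \<Rightarrow> nat \<Rightarrow> nat" where
  "diff_point_code m n = add_code m (scale_code (real_coeff_code (-1) 0) n)"

lemma rat_point_add: "rat_point ct a (add_code m n) = rat_point ct a m + rat_point ct a n"
  by (simp add: rat_point_eq_sum_list add_code_def)

lemma rat_point_mult: "rat_point ct a (mult_code ct m n) = rat_point ct a m * rat_point ct a n"
proof -
  have "sum_list (map (term_val ct a) (concat (map (\<lambda>s. map (term_mult_code ct s) ys) xs)))
      = sum_list (map (term_val ct a) xs) * sum_list (map (term_val ct a) ys)" for xs ys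
  proof (induction xs)
    case (Cons x xs)
    have "sum_list (map (term_val ct a) (map (term_mult_code ct x) ys))
        = term_val ct a x * sum_list (map (term_val ct a) ys)"
      by (induction ys) (simp_all add: term_val_def term_mult_code_def coeff_val_mult word_val_mult
          mult_scaleC_left' mult_scaleC_right' scaleC_scaleC distrib_left mult.commute)
    with Cons show ?case by (simp add: distrib_right)
  qed simp
  then show ?thesis by (simp add: rat_point_eq_sum_list mult_code_def)
qed

lemma rat_point_scale: "rat_point ct a (scale_code c n) = scaleC (coeff_val c) (rat_point ct a n)"
proof -
  have "sum_list (map (term_val ct a) (map (term_scale_code c) xs))
      = scaleC (coeff_val c) (sum_list (map (term_val ct a) xs))" for xs
    by (induction xs) (simp_all add: term_val_def term_scale_code_def coeff_val_mult scaleC_scaleC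
        scaleC_add_right)
  then show ?thesis by (simp add: rat_point_eq_sum_list scale_code_def)
qed

lemma rat_point_star: "rat_point ct a (star_code ct n) = star (rat_point ct a n)"
proof -
  have "sum_list (map (term_val ct a) (map (term_star_code ct) xs))
      = star (sum_list (map (term_val ct a) xs))" for xs
    by (induction xs) (simp_all add: term_val_def term_star_code_def coeff_val_cnj word_val_star
        star_scaleC star_add)
  then show ?thesis by (simp add: rat_point_eq_sum_list star_code_def)
qed

lemma rat_point_diff: "rat_point ct a (diff_point_code m n) = rat_point ct a m - rat_point ct a n"
  by (simp add: diff_point_code_def rat_point_add rat_point_scale coeff_val_real del: of_real_minus)

subsection \<open>Computability of the arithmetic\<close>

lemma computable_diff_code [computable_intros]:
  assumes "computable_fun f" "computable_fun g" shows "computable_fun (\<lambda>x. diff_code (f x) (g x))"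
  unfolding diff_code_def by (intro computable_intros assms)

lemma computable_int_pos [computable_intros]:
  assumes "computable_fun f" shows "computable_fun (\<lambda>x. int_pos (f x))"
  unfolding int_pos_def by (intro computable_intros assms)

lemma computable_int_neg [computable_intros]:
  assumes "computable_fun f" shows "computable_fun (\<lambda>x. int_neg (f x))"
  unfolding int_neg_def by (intro computable_intros assms)

lemma computable_coeff_mult_code [computable_intros]:
  assumes "computable_fun f" "computable_fun g"
  shows "computable_fun (\<lambda>x. coeff_mult_code (f x) (g x))"
  unfolding coeff_mult_code_def rat_add_code_def rat_mult_code_def rat_minus_code_def
  by (intro computable_intros assms)

lemma computable_coeff_cnj_code [computable_intros]:
  assumes "computable_fun f" shows "computable_fun (\<lambda>x. coeff_cnj_code (f x))"
  unfolding coeff_cnj_code_def rat_minus_code_def by (intro computable_intros assms)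

lemma computable_word_mult_code [computable_intros]:
  assumes "computable_fun f" "computable_fun g"
  shows "computable_fun (\<lambda>x. word_mult_code ct (f x) (g x))"
  unfolding word_mult_code_def letters_code_def letters_def
  by (cases ct) (simp_all only: if_True if_False, (intro computable_intros assms)+)

lemma computable_word_star_code [computable_intros]:
  assumes "computable_fun f" shows "computable_fun (\<lambda>x. word_star_code ct (f x))"
  unfolding word_star_code_def letters_code_def letters_def flip_letter_def
  by (cases ct) (simp_all only: if_True if_False, (intro computable_intros assms)+)

lemma computable_term_mult_code [computable_intros]:
  assumes "computable_fun f" "computable_fun g"
  shows "computable_fun (\<lambda>x. term_mult_code ct (f x) (g x))"
  unfolding term_mult_code_def by (intro computable_intros assms)

lemma computable_add_code [computable_intros]:
  assumes "computable_fun f" "computable_fun g" shows "computable_fun (\<lambda>x. add_code (f x) (g x))"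
  unfolding add_code_def by (intro computable_intros assms)

lemma computable_mult_code [computable_intros]:
  assumes "computable_fun f" "computable_fun g"
  shows "computable_fun (\<lambda>x. mult_code ct (f x) (g x))"
  by (rule computable_app2'[where h="mult_code ct", OF _ assms])
     (unfold mult_code_def, intro computable_intros)

lemma computable_scale_code [computable_intros]:
  assumes "computable_fun f" "computable_fun g"
  shows "computable_fun (\<lambda>x. scale_code (f x) (g x))"
  by (rule computable_app2'[where h=scale_code, OF _ assms])
     (unfold scale_code_def term_scale_code_def, intro computable_intros)

lemma computable_star_code [computable_intros]:
  assumes "computable_fun f" shows "computable_fun (\<lambda>x. star_code ct (f x))"
  unfolding star_code_def term_star_code_def by (intro computable_intros assms)

lemma computable_diff_point_code [computable_intros]:
  assumes "computable_fun f" "computable_fun g"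
  shows "computable_fun (\<lambda>x. diff_point_code (f x) (g x))"
  unfolding diff_point_code_def by (intro computable_intros assms)

section \<open>Density of the rational points\<close>

lemma ex_rat_of_code: "\<exists>n. rat_of_code n = q"
proof (cases q rule: Rat_cases)
  case (Fract p d)
  then have "rat_of_code (prod_encode (int_encode p, nat d - 1)) = q"
    by (simp add: rat_of_code_pair Fract_of_int_quotient)
  then show ?thesis ..
qed

lemma ex_coeff_val_approx: "e > 0 \<Longrightarrow> \<exists>k. cmod (coeff_val k - c) < e"
proof -
  assume "e > 0"
  have "\<exists>i. \<bar>of_rat (rat_of_code i) - r\<bar> < e / 2" for r :: real
  proof -
    have "r - e / 2 < r + e / 2" using \<open>e > 0\<close> by simp
    then obtain q where "r - e / 2 < of_rat q" "of_rat q < r + e / 2"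
      using of_rat_dense by blast
    moreover obtain i where "rat_of_code i = q" using ex_rat_of_code by blast
    moreover from calculation have "\<bar>of_rat q - r\<bar> < e / 2" by linarith
    ultimately show ?thesis by blast
  qed
  then obtain i j where "\<bar>of_rat (rat_of_code i) - Re c\<bar> < e / 2" "\<bar>of_rat (rat_of_code j) - Im c\<bar> < e / 2"
    by blast
  then have "cmod (coeff_val (prod_encode (i, j)) - c) < e"
    using cmod_le[of "coeff_val (prod_encode (i, j)) - c"] by (simp add: coeff_val_def)
  then show ?thesis ..
qed

lemma special_point_in_range: "a i \<in> range (rat_point ct a)"
proof -
  have "letters ct (letters_code ct [2 * i]) = [2 * i]" by (rule letters_code_inverse) simp
  then have "word_val ct a (letters_code ct [2 * i]) = a i"
    by (simp add: word_val_eq letter_of_code_def eval_word_def)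
  then have "rat_point ct a (list_encode [prod_encode (real_coeff_code 1 0, letters_code ct [2 * i])]) = a i"
    unfolding rat_point_eq_sum_list list_encode_inverse
    by (simp add: term_val_def coeff_val_real)
  then show ?thesis by (metis rangeI)
qed

lemma one_in_range: "1 \<in> range (rat_point True a)"
proof -
  have "word_val True a 0 = 1" by (simp add: word_val_def word_of_code_def eval_word_def)
  then have "rat_point True a (list_encode [prod_encode (real_coeff_code 1 0, 0)]) = 1"
    unfolding rat_point_eq_sum_list list_encode_inverse
    by (simp add: term_val_def coeff_val_real)
  then show ?thesis by (metis rangeI)
qed

text \<open>
  The closure of the rational points is a C*-subalgebra that contains the special points; scalars are
  dealt with by approximating them by Gaussian rationals.
\<close>

lemma rat_points_dense:
  fixes a :: "nat \<Rightarrow> 'a::unital_cstar_algebra"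
  assumes "presentation ct a"
  shows "closure (range (rat_point ct a)) = UNIV"
proof -
  define S where "S = closure (range (rat_point ct a))"
  have sub: "x \<in> S" if "x \<in> range (rat_point ct a)" for x
    unfolding S_def by (rule subsetD[OF closure_subset that])
  have seq: "\<exists>i. (\<lambda>n. rat_point ct a (i n)) \<longlonglongrightarrow> x" if "x \<in> S" for x
  proof -
    obtain f where f: "\<forall>n. f n \<in> range (rat_point ct a)" "f \<longlonglongrightarrow> x"
      using \<open>x \<in> S\<close> unfolding S_def closure_sequential by auto
    from f(1) have "\<forall>n. \<exists>i. f n = rat_point ct a i" by (simp add: image_iff)
    then obtain i where "\<forall>n. f n = rat_point ct a (i n)" by (rule choice[THEN exE])
    then have "f = (\<lambda>n. rat_point ct a (i n))" by (simp add: fun_eq_iff)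
    with f(2) show ?thesis by auto
  qed
  have lim: "x \<in> S" if "(\<lambda>n. rat_point ct a (i n)) \<longlonglongrightarrow> x" for x i
    unfolding S_def closure_sequential using that by (intro exI[of _ "\<lambda>n. rat_point ct a (i n)"]) auto
  have clS: "closed S" by (simp add: S_def)
  have "cstar_subalgebra ct S"
    unfolding cstar_subalgebra_def
  proof (intro conjI ballI allI impI)
    show "closed S" by (rule clS)
    have "rat_point ct a 0 = 0" by (simp add: rat_point_eq_sum_list)
    then show "0 \<in> S" by (intro sub) (metis rangeI)
    show "1 \<in> S" if ct using sub one_in_range[of a] that by simp
    fix x y assume "x \<in> S" "y \<in> S"
    then obtain i j where ij: "(\<lambda>n. rat_point ct a (i n)) \<longlonglongrightarrow> x" "(\<lambda>n. rat_point ct a (j n)) \<longlonglongrightarrow> y"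
      using seq by meson
    show "x + y \<in> S"
      using tendsto_add[OF ij] by (intro lim[of "\<lambda>n. add_code (i n) (j n)"]) (simp add: rat_point_add)
    show "x * y \<in> S"
      using tendsto_mult[OF ij] by (intro lim[of "\<lambda>n. mult_code ct (i n) (j n)"]) (simp add: rat_point_mult)
  next
    fix x assume "x \<in> S"
    then obtain i where i: "(\<lambda>n. rat_point ct a (i n)) \<longlonglongrightarrow> x" using seq by meson
    show "star x \<in> S"
      using tendsto_star[OF i] by (intro lim[of "\<lambda>n. star_code ct (i n)"]) (simp add: rat_point_star)
    have scale: "scaleC (coeff_val k) x \<in> S" for k
      using tendsto_scaleC_right[OF i, of "coeff_val k"]
      by (intro lim[of "\<lambda>n. scale_code k (i n)"]) (simp add: rat_point_scale)
    fix c
    have "\<exists>k. cmod (coeff_val k - c) < 1 / real (Suc n)" for n by (rule ex_coeff_val_approx) simp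
    then obtain k where k: "\<And>n. cmod (coeff_val (k n) - c) < 1 / real (Suc n)" by metis
    have "(\<lambda>n. coeff_val (k n)) \<longlonglongrightarrow> c"
    proof (rule LIM_zero_cancel, rule Lim_null_comparison)
      show "\<forall>\<^sub>F n in sequentially. cmod (coeff_val (k n) - c) \<le> inverse (real (Suc n))"
        using less_imp_le[OF k] by (simp add: inverse_eq_divide)
    qed (rule LIMSEQ_inverse_real_of_nat)
    then have "(\<lambda>n. scaleC (coeff_val (k n)) x) \<longlonglongrightarrow> scaleC c x" by (rule tendsto_scaleC_left)
    with clS scale show "scaleC c x \<in> S" by (rule closed_sequentially)
  qed
  moreover have "range a \<subseteq> S" using special_point_in_range sub by blast
  ultimately have "cstar_subalgebra ct hull range a \<subseteq> S" by (intro hull_minimal)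
  with assms show ?thesis by (auto simp: presentation_def S_def)
qed

text \<open>
  Density, in the form in which it serves to replace ideal elements by rational points: a property that
  is stable under small perturbations of \<open>u\<close> is shared by a rational point.
\<close>

lemma open_rat_point:
  fixes a :: "nat \<Rightarrow> 'a::unital_cstar_algebra"
  assumes "presentation ct a" and "\<forall>\<^sub>F z in nhds u. P z"
  shows "\<exists>c. P (rat_point ct a c)"
proof -
  obtain S where "open S" "u \<in> S" "\<And>z. z \<in> S \<Longrightarrow> P z"
    using assms(2) unfolding eventually_nhds by blast
  moreover have "u \<in> closure (range (rat_point ct a))" using rat_points_dense[OF assms(1)] by simp
  ultimately have "S \<inter> range (rat_point ct a) \<noteq> {}"
    using open_Int_closure_eq_empty[of S "range (rat_point ct a)"] by blast
  then show ?thesis using \<open>\<And>z. z \<in> S \<Longrightarrow> P z\<close> by blast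
qed

section \<open>Deciding norm inequalities with tolerance\<close>

text \<open>
  The inequality \<open>\<parallel>x\<parallel> < 2\<^sup>-\<^sup>n\<close> need not be decidable, but it can be told apart from \<open>\<parallel>x\<parallel> < 2\<^sup>-\<^sup>n\<^sup>-\<^sup>1\<close> by comparing an
  approximation of the norm with a threshold halfway between.
\<close>

lemma small_test:
  fixes a :: "nat \<Rightarrow> 'a::unital_cstar_algebra"
  assumes "computable_presentation ct a"
  obtains small where
    "\<And>f g. computable_fun f \<Longrightarrow> computable_fun g \<Longrightarrow> computable_pred (\<lambda>x. small (f x) (g x))"
    "\<And>i n. norm (rat_point ct a i) < 1 / 2 ^ Suc n \<Longrightarrow> small i n"
    "\<And>i n. small i n \<Longrightarrow> norm (rat_point ct a i) < 1 / 2 ^ n"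
proof -
  obtain f where f: "computable_fun2 f"
    and q: "\<And>i k. \<bar>norm (rat_point ct a i) - of_rat (rat_of_code (f i k))\<bar> < 1 / 2 ^ k"
    using assms unfolding computable_presentation_def by blast
  \<comment> \<open>The comparison \<open>q < 3/4 / 2\<^sup>n\<close> of rationals, cleared of denominators and signs.\<close>
  define small where "small i n \<longleftrightarrow> int_pos (pfst (f i (n + 3))) * 4 * 2 ^ n
      < 3 * Suc (psnd (f i (n + 3))) + int_neg (pfst (f i (n + 3))) * 4 * 2 ^ n" for i n
  have small_iff: "small i n \<longleftrightarrow> of_rat (rat_of_code (f i (n + 3))) < (3/4 / 2 ^ n :: real)" for i n
  proof -
    have "small i n \<longleftrightarrow> real (int_pos (pfst (f i (n + 3))) * 4 * 2 ^ n)
      < real (3 * Suc (psnd (f i (n + 3))) + int_neg (pfst (f i (n + 3))) * 4 * 2 ^ n)"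
      unfolding small_def of_nat_less_iff ..
    also have "\<dots> \<longleftrightarrow> of_rat (rat_of_code (f i (n + 3))) < (3/4 / 2 ^ n :: real)"
      unfolding rat_of_code_eq
      by (simp add: of_rat_divide of_rat_diff divide_simps del: of_nat_Suc)
        (simp add: algebra_simps)
    finally show ?thesis .
  qed
  show ?thesis
  proof (rule that[of small])
    show "computable_pred (\<lambda>x. small (g x) (h x))" if "computable_fun g" "computable_fun h" for g h
      unfolding small_def by (intro computable_intros that computable_app2[OF f])
    show "small i n" if "norm (rat_point ct a i) < 1 / 2 ^ Suc n" for i n
      using q[of i "n + 3"] that unfolding small_iff by (simp add: power_add abs_less_iff field_simps)
    show "norm (rat_point ct a i) < 1 / 2 ^ n" if "small i n" for i n
      using q[of i "n + 3"] that unfolding small_iff by (simp add: power_add abs_less_iff field_simps)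
  qed
qed

text \<open>
  The code of a rational number bounds its numerator, hence the number itself.
\<close>

lemma computable_norm_bound:
  fixes a :: "nat \<Rightarrow> 'a::unital_cstar_algebra"
  assumes "computable_presentation ct a"
  obtains F where "computable_fun F" "\<And>i. norm (rat_point ct a i) \<le> 2 ^ F i"
proof -
  obtain f where f: "computable_fun2 f"
    and q: "\<And>i k. \<bar>norm (rat_point ct a i) - of_rat (rat_of_code (f i k))\<bar> < 1 / 2 ^ k"
    using assms unfolding computable_presentation_def by blast
  have "norm (rat_point ct a i) \<le> 2 ^ f i 0" for i
  proof -
    define r where "r = f i 0"
    have "int_pos (pfst r) \<le> pfst r" by (simp add: int_pos_def)
    also have "pfst r \<le> r" using le_prod_encode_1[of "pfst r" "psnd r"] by simp
    finally have pos: "real (int_pos (pfst r)) \<le> real r" by simp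
    have "of_rat (rat_of_code r) = (real (int_pos (pfst r)) - real (int_neg (pfst r))) / real (Suc (psnd r))"
      by (simp add: rat_of_code_eq of_rat_divide of_rat_diff del: of_nat_Suc)
    also have "\<dots> \<le> real (int_pos (pfst r)) / real (Suc (psnd r))" by (intro divide_right_mono) auto
    also have "\<dots> \<le> real (int_pos (pfst r)) / 1" by (intro divide_left_mono) auto
    finally have "norm (rat_point ct a i) \<le> real r + 1" using q[of i 0] pos by (simp add: r_def)
    also have "real r + 1 \<le> 2 ^ r" proof -
      have "real (Suc r) \<le> real (2 ^ r)" using less_exp[of r] by (simp only: of_nat_le_iff Suc_le_eq)
      then show ?thesis by simp
    qed
    finally show ?thesis by (simp add: r_def)
  qed
  moreover have "computable_fun (\<lambda>i. f i 0)" by (intro computable_app2[OF f] computable_intros)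
  ultimately show ?thesis using that by blast
qed

section \<open>Unitary parts by Newton iteration\<close>

text \<open>
  Newton's iteration for the polar decomposition, in a form that avoids inverses. The constant \<open>3/2\<close>
  multiplies \<open>u\<close> and not the unit, so no unit is needed to evaluate it.
\<close>

definition newton :: "'a::unital_cstar_algebra \<Rightarrow> 'a" where
  "newton u = (3/2) *\<^sub>R u - (1/2) *\<^sub>R (u * star u * u)"

lemma star_newton: "star (newton u) = newton (star u)"
  by (simp add: newton_def star_diff star_mult star_star mult.assoc)

lemma newton_eq: "newton u = u + (1/2) *\<^sub>R (u * (1 - star u * u))"
proof -
  have "(3/2) *\<^sub>R u = u + (1/2) *\<^sub>R u" using scaleR_left_distrib[of 1 "1/2" u] by simp
  then show ?thesis by (simp add: newton_def algebra_simps mult.assoc)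
qed

text \<open>
  With \<open>u\<^sup>* u = 1 - e\<close> the new product is \<open>(1 + e/2) (1 - e) (1 + e/2)\<close>, in which the terms linear in \<open>e\<close>
  cancel.
\<close>

lemma newton_defect_eq:
  fixes u :: "'a::unital_cstar_algebra"
  defines "e \<equiv> 1 - star u * u"
  shows "1 - star (newton u) * newton u = (3/4) *\<^sub>R (e * e) + (1/4) *\<^sub>R (e * e * e)"
proof -
  have uu: "star u * u = 1 - e" by (simp add: e_def)
  have se: "star e = e" by (simp add: e_def star_diff star_mult star_star)
  have n: "newton u = u * (1 + (1/2) *\<^sub>R e)" by (simp add: newton_eq e_def[symmetric] algebra_simps)
  have "star (newton u) = (1 + (1/2) *\<^sub>R e) * star u"
    unfolding n by (simp add: star_mult star_add se)
  then have "star (newton u) * newton u = (1 + (1/2) *\<^sub>R e) * (star u * u) * (1 + (1/2) *\<^sub>R e)"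
    unfolding n by (simp add: mult.assoc)
  also have "\<dots> = (1 + (1/2) *\<^sub>R e) * (1 - e) * (1 + (1/2) *\<^sub>R e)" by (simp add: uu)
  also have "\<dots> = 1 + ((1/2) *\<^sub>R e + (1/2) *\<^sub>R e - e)
      - ((1/2) *\<^sub>R (e * e) + (1/2) *\<^sub>R (e * e) - (1/4) *\<^sub>R (e * e)) - (1/4) *\<^sub>R (e * e * e)"
    by (simp add: algebra_simps)
  also have "(1/2) *\<^sub>R e + (1/2) *\<^sub>R e - e = 0" by (simp flip: scaleR_left_distrib)
  also have "(1/2) *\<^sub>R (e * e) + (1/2) *\<^sub>R (e * e) - (1/4) *\<^sub>R (e * e) = (3/4) *\<^sub>R (e * e)"
    unfolding scaleR_left_distrib[symmetric] scaleR_left_diff_distrib[symmetric] by simp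
  finally show ?thesis by simp
qed

lemma newton_defect_le:
  fixes u :: "'a::unital_cstar_algebra"
  assumes e: "norm (1 - star u * u) \<le> \<epsilon>" and \<epsilon>: "\<epsilon> \<le> 1/2"
  shows "norm (1 - star (newton u) * newton u) \<le> \<epsilon> / 2"
proof -
  define d where "d = 1 - star u * u"
  have d: "norm d \<le> \<epsilon>" and \<epsilon>0: "0 \<le> \<epsilon>"
    using e order_trans[OF norm_ge_zero e] by (simp_all add: d_def)
  have "norm ((3/4) *\<^sub>R (d * d) + (1/4) *\<^sub>R (d * d * d)) \<le> 3/4 * (\<epsilon> * \<epsilon>) + 1/4 * (\<epsilon> * \<epsilon> * \<epsilon>)"
    by (rule norm_triangle_le)
       (simp only: norm_scaleR, intro add_mono mult_mono norm_mult_le2 d, auto)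
  also have "\<dots> = \<epsilon> * (3/4 * \<epsilon> + 1/4 * (\<epsilon> * \<epsilon>))" by (simp add: algebra_simps)
  also have "\<dots> \<le> \<epsilon> * (1/2)"
  proof (rule mult_left_mono[OF _ \<epsilon>0])
    have "\<epsilon> * \<epsilon> \<le> 1/2 * (1/2)" using \<epsilon> \<epsilon>0 by (intro mult_mono) auto
    then show "3/4 * \<epsilon> + 1/4 * (\<epsilon> * \<epsilon>) \<le> 1/2" using \<epsilon> by linarith
  qed
  finally show ?thesis unfolding newton_defect_eq d_def by simp
qed

lemma norm_sq_le_if_defect:
  fixes u :: "'a::unital_cstar_algebra"
  assumes "norm (1 - star u * u) \<le> 1" shows "norm u * norm u \<le> 2"
proof -
  have "norm u * norm u = norm (1 - (1 - star u * u))"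
    using cstar_identity[of u] by (simp add: power2_eq_square)
  also have "\<dots> \<le> 2" using norm_triangle_ineq4[of 1 "1 - star u * u"] assms norm_one_le[where 'a='a] by simp
  finally show ?thesis .
qed

text \<open>
  The iteration commutes with the involution, so that the estimate for \<open>1 - u\<^sup>* u\<close> also applies to
  \<open>1 - u u\<^sup>*\<close>; controlling both makes the limit unitary and not only isometric. Halving the defect in each
  step is far from the quadratic convergence of the method but suffices.
\<close>

lemma newton_limit:
  fixes u :: "'a::unital_cstar_algebra"
  assumes e: "norm (1 - star u * u) \<le> \<epsilon>" "norm (1 - u * star u) \<le> \<epsilon>" and \<epsilon>: "\<epsilon> \<le> 1/2"
  obtains v where "unitary v" "\<And>k. norm (v - (newton ^^ k) u) \<le> 2 * \<epsilon> / 2 ^ k"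
proof -
  define U where "U k = (newton ^^ k) u" for k
  have U0: "U 0 = u" and US: "U (Suc k) = newton (U k)" for k by (simp_all add: U_def)
  have \<epsilon>0: "0 \<le> \<epsilon>" using order_trans[OF norm_ge_zero e(1)] .
  have small: "\<epsilon> / 2 ^ k \<le> 1/2" for k
  proof -
    have "\<epsilon> / 2 ^ k \<le> \<epsilon> / 1" by (rule divide_left_mono) (use \<epsilon>0 in auto)
    also have "\<epsilon> / 1 \<le> 1/2" using \<epsilon> by simp
    finally show ?thesis .
  qed
  have defect: "norm (1 - star (U k) * U k) \<le> \<epsilon> / 2 ^ k \<and> norm (1 - U k * star (U k)) \<le> \<epsilon> / 2 ^ k" for k
  proof (induction k)
    case (Suc k)
    have "norm (1 - star (U (Suc k)) * U (Suc k)) \<le> \<epsilon> / 2 ^ k / 2"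
      unfolding US using Suc small by (intro newton_defect_le) auto
    moreover have "norm (1 - star (newton (star (U k))) * newton (star (U k))) \<le> \<epsilon> / 2 ^ k / 2"
      using Suc small by (intro newton_defect_le) (auto simp: star_star)
    then have "norm (1 - U (Suc k) * star (U (Suc k))) \<le> \<epsilon> / 2 ^ k / 2"
      by (simp add: US star_newton star_star)
    ultimately show ?case by simp
  qed (simp add: U0 e)
  have "norm (U (Suc k) - U k) \<le> \<epsilon> / 2 ^ k" for k
  proof -
    have "norm (U k) * norm (U k) \<le> 2"
      using defect[of k] small[of k] by (intro norm_sq_le_if_defect) linarith
    then have "(norm (U k))\<^sup>2 \<le> 2\<^sup>2" by (simp add: power2_eq_square)
    then have "norm (U k) \<le> 2" by (rule power2_le_imp_le) simp
    then have "norm (U k * (1 - star (U k) * U k)) \<le> 2 * (\<epsilon> / 2 ^ k)"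
      using defect by (intro norm_mult_le2) auto
    then show ?thesis by (simp add: US newton_eq mult.commute)
  qed
  then obtain v where v: "U \<longlonglongrightarrow> v" "\<And>k. norm (v - U k) \<le> 2 * \<epsilon> / 2 ^ k"
    using geometric_tail_limit[of 0 U \<epsilon>] by auto
  have null: "(\<lambda>k. \<epsilon> / 2 ^ k) \<longlonglongrightarrow> 0" by (rule LIMSEQ_divide_realpow_zero) simp
  have "(\<lambda>k. 1 - star (U k) * U k) \<longlonglongrightarrow> 0" "(\<lambda>k. 1 - U k * star (U k)) \<longlonglongrightarrow> 0"
    using defect by (auto intro!: Lim_null_comparison[OF always_eventually null])
  moreover have "(\<lambda>k. 1 - star (U k) * U k) \<longlonglongrightarrow> 1 - star v * v"
    "(\<lambda>k. 1 - U k * star (U k)) \<longlonglongrightarrow> 1 - v * star v"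
    by (intro tendsto_intros v)+
  ultimately have "1 - star v * v = 0" "1 - v * star v = 0" using LIMSEQ_unique by blast+
  then have "unitary v" by (simp add: unitary_def)
  with v(2) show ?thesis using that by (simp add: U_def)
qed

section \<open>Approximate intertwining\<close>

definition conj_by :: "'a::unital_cstar_algebra \<Rightarrow> 'a \<Rightarrow> 'a" where
  "conj_by u x = u * x * star u"

lemma conj_by_diff: "conj_by u x - conj_by u y = conj_by u (x - y)"
  by (simp add: conj_by_def algebra_simps)

lemma conj_by_mult: "conj_by (u * v) x = conj_by u (conj_by v x)"
  by (simp add: conj_by_def star_mult mult.assoc)

lemma conj_by_1 [simp]: "conj_by 1 x = x"
  by (simp add: conj_by_def)

lemma tendsto_conj_by [tendsto_intros]:
  assumes "(f \<longlongrightarrow> u) F" "(g \<longlongrightarrow> x) F" shows "((\<lambda>i. conj_by (f i) (g i)) \<longlongrightarrow> conj_by u x) F"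
  unfolding conj_by_def by (intro tendsto_intros assms)

lemma norm_conj_by_le: "norm (conj_by u x) \<le> norm u * norm u * norm x"
proof -
  have "norm (conj_by u x) \<le> (norm u * norm x) * norm (star u)"
    unfolding conj_by_def by (intro norm_mult_le2) auto
  then show ?thesis by (simp add: mult_ac)
qed

lemma norm_conj_by_unitary:
  assumes "unitary u" shows "norm (conj_by u x) = norm x"
proof -
  have le: "norm (conj_by v y) \<le> norm y" if "unitary v" for v y :: 'a
  proof -
    have v: "norm v \<le> 1" using that unitary_norm_le by (auto simp: unitary_def)
    then have "norm v * norm v \<le> 1 * 1" by (intro mult_mono) auto
    then have "norm v * norm v * norm y \<le> 1 * norm y" by (intro mult_right_mono) auto
    then show ?thesis using norm_conj_by_le[of v y] by simp
  qed
  have su: "unitary (star u)" using assms by (simp add: unitary_def star_star)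
  have "x = conj_by (star u) (conj_by u x)" using assms by (simp add: unitary_def flip: conj_by_mult)
  then have "norm x \<le> norm (conj_by u x)" using le[OF su] by metis
  with le[OF assms, of x] show ?thesis by simp
qed

lemma norm_conj_by_diff_le:
  "norm (conj_by u x - conj_by v x) \<le> norm (u - v) * (norm u + norm v) * norm x"
proof -
  have "conj_by u x - conj_by v x = (u - v) * x * star u + v * x * star (u - v)"
    by (simp add: conj_by_def star_diff algebra_simps)
  also have "norm \<dots> \<le> (norm (u - v) * norm x) * norm (star u) + (norm v * norm x) * norm (star (u - v))"
    by (intro norm_triangle_le add_mono norm_mult_le2) auto
  finally show ?thesis by (simp only: norm_star) (simp add: algebra_simps)
qed

text \<open>
  All maps \<open>x \<mapsto> v\<^sub>n \<phi>(x) v\<^sub>n\<^sup>*\<close> are isometric, so pointwise convergence on a dense set spreads to the whole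
  algebra, and the limit inherits the algebraic identities.
\<close>

lemma star_hom_conj_by_limit:
  fixes \<phi> :: "'a::unital_cstar_algebra \<Rightarrow> 'b::unital_cstar_algebra"
  assumes hom: "star_hom \<phi>" and iso: "\<And>x. norm (\<phi> x) = norm x"
    and v: "\<And>n. unitary (v n)" and dense: "closure X = UNIV"
    and conv: "\<And>x. x \<in> X \<Longrightarrow> convergent (\<lambda>n. conj_by (v n) (\<phi> x))"
  obtains \<psi> where "star_hom \<psi>" "\<And>x. norm (\<psi> x) = norm x"
    "\<And>x. (\<lambda>n. conj_by (v n) (\<phi> x)) \<longlonglongrightarrow> \<psi> x"
proof -
  note [simp] = star_hom_simps[OF hom]
  have "convergent (\<lambda>n. conj_by (v n) (\<phi> x))" for x
  proof (rule Cauchy_convergent, rule CauchyI)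
    fix e :: real assume e: "e > 0"
    have "x \<in> closure X" by (simp add: dense)
    then obtain x' where x': "x' \<in> X" "dist x' x < e / 3"
      using e by (meson closure_approachable divide_pos_pos zero_less_numeral)
    have close: "norm (conj_by (v n) (\<phi> x) - conj_by (v n) (\<phi> x')) < e / 3" for n
    proof -
      have "conj_by (v n) (\<phi> x) - conj_by (v n) (\<phi> x') = conj_by (v n) (\<phi> (x - x'))"
        by (simp add: conj_by_diff)
      then show ?thesis
        using x'(2) by (simp add: norm_conj_by_unitary[OF v] iso dist_norm norm_minus_commute
            del: star_hom_diff[OF hom])
    qed
    have "Cauchy (\<lambda>n. conj_by (v n) (\<phi> x'))" using conv[OF x'(1)] by (simp add: Cauchy_convergent_iff)
    then obtain N where N: "norm (conj_by (v m) (\<phi> x') - conj_by (v n) (\<phi> x')) < e / 3"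
      if "m \<ge> N" "n \<ge> N" for m n
      using e by (meson CauchyD divide_pos_pos zero_less_numeral)
    have "norm (conj_by (v m) (\<phi> x) - conj_by (v n) (\<phi> x)) < e" if "m \<ge> N" "n \<ge> N" for m n
    proof -
      have "conj_by (v m) (\<phi> x) - conj_by (v n) (\<phi> x) = (conj_by (v m) (\<phi> x) - conj_by (v m) (\<phi> x'))
          + (conj_by (v m) (\<phi> x') - conj_by (v n) (\<phi> x')) - (conj_by (v n) (\<phi> x) - conj_by (v n) (\<phi> x'))"
        by simp
      also have "norm \<dots> < e / 3 + e / 3 + e / 3"
        by (intro norm_triangle_lt norm_diff_triangle_less add_strict_mono close N that
            order_le_less_trans[OF norm_triangle_ineq4] order_le_less_trans[OF norm_triangle_ineq])
      finally show ?thesis by simp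
    qed
    then show "\<exists>N. \<forall>m\<ge>N. \<forall>n\<ge>N. norm (conj_by (v m) (\<phi> x) - conj_by (v n) (\<phi> x)) < e" by blast
  qed
  then obtain \<psi> where \<psi>: "\<And>x. (\<lambda>n. conj_by (v n) (\<phi> x)) \<longlonglongrightarrow> \<psi> x"
    unfolding convergent_def by metis
  have vs: "star (v n) * v n = 1" "v n * star (v n) = 1" for n using v by (auto simp: unitary_def)
  have "star_hom \<psi>"
    unfolding star_hom_def
  proof (intro conjI allI)
    fix x y c
    show "\<psi> (x + y) = \<psi> x + \<psi> y"
      by (rule LIMSEQ_unique[OF \<psi>]) (use tendsto_add[OF \<psi> \<psi>] in \<open>simp add: conj_by_def algebra_simps\<close>)
    show "\<psi> (scaleC c x) = scaleC c (\<psi> x)"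
      by (rule LIMSEQ_unique[OF \<psi>])
        (use tendsto_scaleC_right[OF \<psi>] in \<open>simp add: conj_by_def mult_scaleC_left' mult_scaleC_right'\<close>)
    show "\<psi> (star x) = star (\<psi> x)"
      by (rule LIMSEQ_unique[OF \<psi>])
        (use tendsto_star[OF \<psi>] in \<open>simp add: conj_by_def star_mult star_star mult.assoc\<close>)
    have "conj_by (v n) (\<phi> (x * y)) = conj_by (v n) (\<phi> x) * conj_by (v n) (\<phi> y)" for n
    proof -
      have "conj_by (v n) (\<phi> x) * conj_by (v n) (\<phi> y) = v n * \<phi> x * (star (v n) * v n) * \<phi> y * star (v n)"
        by (simp only: conj_by_def mult.assoc)
      then show ?thesis by (simp add: vs conj_by_def mult.assoc)
    qed
    then show "\<psi> (x * y) = \<psi> x * \<psi> y"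
      using LIMSEQ_unique[OF \<psi>] tendsto_mult[OF \<psi> \<psi>] by simp
    show "\<psi> 1 = 1" by (rule LIMSEQ_unique[OF \<psi>]) (simp add: conj_by_def vs)
  qed
  moreover have "norm (\<psi> x) = norm x" for x
    using tendsto_norm[OF \<psi>, of x] by (simp add: norm_conj_by_unitary[OF v] iso LIMSEQ_const_iff)
  ultimately show ?thesis using that \<psi> by blast
qed

text \<open>
  The range of an isometric linear map on a complete space is closed.
\<close>

lemma isometric_hom_bij_if_dense_range:
  fixes \<psi> :: "'a::unital_cstar_algebra \<Rightarrow> 'b::unital_cstar_algebra"
  assumes hom: "star_hom \<psi>" and iso: "\<And>x. norm (\<psi> x) = norm x"
    and dense: "closure (range \<psi>) = UNIV"
  shows "bij \<psi>"
proof (rule bijI)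
  have dist: "norm (\<psi> x - \<psi> y) = norm (x - y)" for x y
    by (simp add: iso flip: star_hom_diff[OF hom])
  show "inj \<psi>" using dist by (metis eq_iff_diff_eq_0 injI norm_eq_zero)
  have "\<exists>x. \<psi> x = y" for y
  proof -
    have "y \<in> closure (range \<psi>)" by (simp add: dense)
    then obtain g where g: "\<forall>n. g n \<in> range \<psi>" "g \<longlonglongrightarrow> y" unfolding closure_sequential by auto
    from g(1) have "\<forall>n. \<exists>x. g n = \<psi> x" by (simp add: image_iff)
    then obtain x where x: "\<forall>n. g n = \<psi> (x n)" by (rule choice[THEN exE])
    have "Cauchy g" using g(2) by (rule LIMSEQ_imp_Cauchy)
    then have "Cauchy x" using x by (simp add: Cauchy_def dist_norm dist)
    then obtain z where z: "x \<longlonglongrightarrow> z" by (auto simp: Cauchy_convergent_iff convergent_def)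
    have "(\<lambda>n. norm (\<psi> (x n) - \<psi> z)) \<longlonglongrightarrow> 0"
      unfolding dist using z by (intro tendsto_norm_zero LIM_zero)
    then have "(\<lambda>n. \<psi> (x n)) \<longlonglongrightarrow> \<psi> z" by (simp add: tendsto_norm_zero_iff LIM_zero_iff)
    moreover have "g = (\<lambda>n. \<psi> (x n))" using x by (simp add: fun_eq_iff)
    ultimately have "g \<longlonglongrightarrow> \<psi> z" by simp
    then show ?thesis using g(2) LIMSEQ_unique by blast
  qed
  then show "surj \<psi>" by (metis surjI surj_def)
qed

text \<open>
  The next unitary is \<open>u = v w\<^sub>n\<close> for large \<open>n\<close>. It acts on \<open>\<phi>(X)\<close> almost like \<open>v\<close> because \<open>w\<^sub>n\<close> almost commutes
  with this finite set, and \<open>u\<^sup>* y u = w\<^sub>n\<^sup>* (v\<^sup>* y v) w\<^sub>n\<close> is close to \<open>\<phi>(A)\<close>.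
\<close>

lemma intertwining_step:
  fixes \<phi> :: "'a::unital_cstar_algebra \<Rightarrow> 'b::unital_cstar_algebra"
  assumes hom: "star_hom \<phi>" and w: "\<And>n. unitary (w n)"
    and comm: "\<And>x. (\<lambda>n. norm (w n * \<phi> x - \<phi> x * w n)) \<longlonglongrightarrow> 0"
    and absorb: "\<And>y. (\<lambda>n. infdist (star (w n) * y * w n) (range \<phi>)) \<longlonglongrightarrow> 0"
    and v: "unitary v" and X: "finite X" and D: "closure D = UNIV" and \<epsilon>: "\<epsilon> > 0"
  obtains u x where "unitary u" "x \<in> D" "norm (conj_by u (\<phi> x) - y) < \<epsilon>"
    "\<And>x. x \<in> X \<Longrightarrow> norm (conj_by u (\<phi> x) - conj_by v (\<phi> x)) < \<epsilon>"
proof -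
  have "\<forall>\<^sub>F n in sequentially. \<forall>x\<in>X. norm (w n * \<phi> x - \<phi> x * w n) < \<epsilon>"
    by (intro eventually_ball_finite X ballI order_tendstoD(2)[OF comm \<epsilon>])
  moreover have "\<forall>\<^sub>F n in sequentially. infdist (star (w n) * (star v * y * v) * w n) (range \<phi>) < \<epsilon> / 2"
    by (rule order_tendstoD(2)[OF absorb]) (use \<epsilon> in simp)
  ultimately have "\<forall>\<^sub>F n in sequentially. (\<forall>x\<in>X. norm (w n * \<phi> x - \<phi> x * w n) < \<epsilon>) \<and>
      infdist (star (w n) * (star v * y * v) * w n) (range \<phi>) < \<epsilon> / 2" by (rule eventually_conj)
  then obtain n where n: "\<And>x. x \<in> X \<Longrightarrow> norm (w n * \<phi> x - \<phi> x * w n) < \<epsilon>"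
    "infdist (star (w n) * (star v * y * v) * w n) (range \<phi>) < \<epsilon> / 2"
    by (auto simp: eventually_sequentially)
  define u where "u = v * w n"
  have ws: "star (w n) * w n = 1" "w n * star (w n) = 1" and vs: "star v * v = 1" "v * star v = 1"
    using w v by (auto simp: unitary_def)
  have su: "star u * u = 1" "u * star u = 1"
  proof -
    have "star u * u = star (w n) * (star v * v) * w n" by (simp add: u_def star_mult mult.assoc)
    then show "star u * u = 1" by (simp add: vs ws)
    have "u * star u = v * (w n * star (w n)) * star v" by (simp add: u_def star_mult mult.assoc)
    then show "u * star u = 1" by (simp add: vs ws)
  qed
  then have u: "unitary u" by (simp add: unitary_def)
  obtain x0 where x0: "dist (star u * y * u) (\<phi> x0) < \<epsilon> / 2"
  proof -
    have "infdist (star u * y * u) (range \<phi>) < \<epsilon> / 2"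
      using n(2) by (simp add: u_def star_mult mult.assoc)
    moreover have "bdd_below (dist (star u * y * u) ` range \<phi>)" by (rule bdd_belowI2[of _ 0]) simp
    ultimately have "\<exists>z\<in>range \<phi>. dist (star u * y * u) z < \<epsilon> / 2"
      by (subst (asm) infdist_notempty) (simp_all only: cINF_less_iff UNIV_not_empty image_is_empty not_False_eq_True)
    then show ?thesis using that by blast
  qed
  have "x0 \<in> closure D" by (simp add: D)
  then obtain x where x: "x \<in> D" "dist x x0 < \<epsilon> / 2"
    using \<epsilon> by (meson closure_approachable divide_pos_pos zero_less_numeral)
  have "norm (\<phi> x - \<phi> x0) \<le> norm (x - x0)"
    using star_hom_norm_le[OF hom, of "x - x0"] by (simp add: star_hom_diff[OF hom])
  then have *: "norm (\<phi> x - star u * y * u) < \<epsilon>"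
    using x(2) x0 norm_triangle_ineq4[of "\<phi> x - \<phi> x0" "star u * y * u - \<phi> x0"] by (simp add: dist_norm)
  have "conj_by u (star u * y * u) = (u * star u) * y * (u * star u)" by (simp only: conj_by_def mult.assoc)
  then have "conj_by u (\<phi> x) - y = conj_by u (\<phi> x - star u * y * u)" by (simp add: su flip: conj_by_diff)
  then have 1: "norm (conj_by u (\<phi> x) - y) < \<epsilon>" using * by (simp add: norm_conj_by_unitary[OF u])
  have 2: "norm (conj_by u (\<phi> x) - conj_by v (\<phi> x)) < \<epsilon>" if "x \<in> X" for x
  proof -
    have "conj_by u (\<phi> x) - conj_by v (\<phi> x) = conj_by v (conj_by (w n) (\<phi> x) - \<phi> x)"
      by (simp add: u_def conj_by_mult conj_by_diff)
    moreover have "conj_by (w n) (\<phi> x) - \<phi> x = (w n * \<phi> x - \<phi> x * w n) * star (w n)"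
      by (simp add: conj_by_def left_diff_distrib mult.assoc ws)
    moreover have "norm (star (w n)) \<le> 1" using unitary_norm_le[OF ws(1)] by simp
    ultimately have "norm (conj_by u (\<phi> x) - conj_by v (\<phi> x)) \<le> norm (w n * \<phi> x - \<phi> x * w n) * 1"
      by (simp only: norm_conj_by_unitary[OF v]) (intro norm_mult_le2, auto)
    with n(1)[OF that] show ?thesis by simp
  qed
  show ?thesis by (rule that[OF u x(1) 1 2])
qed

section \<open>The effective intertwining\<close>

definition newton_code :: "bool \<Rightarrow> nat \<Rightarrow> nat" where
  "newton_code ct c = diff_point_code (scale_code (real_coeff_code 3 1) c)
     (scale_code (real_coeff_code 1 1) (mult_code ct (mult_code ct c (star_code ct c)) c))"

lemma rat_point_newton:
  fixes a :: "nat \<Rightarrow> 'a::unital_cstar_algebra"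
  shows "rat_point ct a (newton_code ct c) = newton (rat_point ct a c)"
proof -
  have "scaleC (coeff_val (real_coeff_code p d)) z = (real_of_int p / real (Suc d)) *\<^sub>R z"
    for p d and z :: 'a by (simp only: coeff_val_real scaleC_of_real)
  then show ?thesis
    by (simp add: newton_code_def newton_def rat_point_diff rat_point_scale rat_point_mult rat_point_star)
qed

lemma rat_point_newton_funpow:
  "rat_point ct a ((newton_code ct ^^ k) c) = (newton ^^ k) (rat_point ct a c)"
  by (induction k) (simp_all add: rat_point_newton)

lemma computable_newton_code [computable_intros]:
  assumes "computable_fun f" shows "computable_fun (\<lambda>x. newton_code ct (f x))"
  unfolding newton_code_def by (intro computable_intros assms)

definition conj_code :: "bool \<Rightarrow> nat \<Rightarrow> nat \<Rightarrow> nat" where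
  "conj_code ct c m = mult_code ct (mult_code ct c m) (star_code ct c)"

lemma rat_point_conj:
  "rat_point ct a (conj_code ct c m) = conj_by (rat_point ct a c) (rat_point ct a m)"
  by (simp add: conj_code_def conj_by_def rat_point_mult rat_point_star)

lemma computable_conj_code [computable_intros]:
  assumes "computable_fun f" "computable_fun g"
  shows "computable_fun (\<lambda>x. conj_code ct (f x) (g x))"
  unfolding conj_code_def by (intro computable_intros assms)

text \<open>
  The locale fixes, besides the data of the theorem, the algorithms that its hypotheses provide: \<open>f\<close>
  approximates \<open>\<phi>\<close> on rational points, \<open>one\<close> approximates the unit of \<open>B\<close>, \<open>F\<close> bounds norms in \<open>A\<close>, and \<open>small\<close>
  tests norms in \<open>B\<close> as in \<open>small_test\<close>.
\<close>

locale effective_intertwining =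
  fixes ct :: bool
    and a :: "nat \<Rightarrow> 'a::unital_cstar_algebra"
    and b :: "nat \<Rightarrow> 'b::unital_cstar_algebra"
    and \<phi> :: "'a \<Rightarrow> 'b"
    and w :: "nat \<Rightarrow> 'b"
    and f :: "nat \<Rightarrow> nat \<Rightarrow> nat" and one F :: "nat \<Rightarrow> nat"
    and small :: "nat \<Rightarrow> nat \<Rightarrow> bool"
  assumes hom: "star_hom \<phi>" and inj: "inj \<phi>"
    and pres_a: "presentation ct a" and pres_b: "presentation ct b"
    and w: "\<And>n. unitary (w n)"
    and comm: "\<And>x. (\<lambda>n. norm (w n * \<phi> x - \<phi> x * w n)) \<longlonglongrightarrow> 0"
    and absorb: "\<And>y. (\<lambda>n. infdist (star (w n) * y * w n) (range \<phi>)) \<longlonglongrightarrow> 0"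
    and f: "computable_fun2 f"
    and f_approx: "\<And>i k. norm (\<phi> (rat_point ct a i) - rat_point ct b (f i k)) < 1 / 2 ^ k"
    and one: "computable_fun one"
    and one_approx: "\<And>k. norm (1 - rat_point ct b (one k)) < 1 / 2 ^ k"
    and F: "computable_fun F"
    and F_bound: "\<And>i. norm (rat_point ct a i) \<le> 2 ^ F i"
    and small: "\<And>g h. computable_fun g \<Longrightarrow> computable_fun h \<Longrightarrow> computable_pred (\<lambda>x. small (g x) (h x))"
    and small_complete: "\<And>i n. norm (rat_point ct b i) < 1 / 2 ^ Suc n \<Longrightarrow> small i n"
    and small_sound: "\<And>i n. small i n \<Longrightarrow> norm (rat_point ct b i) < 1 / 2 ^ n"
begin

abbreviation x where "x \<equiv> rat_point ct a"
abbreviation y where "y \<equiv> rat_point ct b"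

text \<open>
  A state of the construction consists of the code of an almost unitary rational point of \<open>B\<close>, a bound
  such that all elements \<open>x i\<close> with smaller index are tracked, and the index \<open>e\<close> for which \<open>\<phi> (x e)\<close> was moved
  close to the latest target in \<open>B\<close>.
\<close>

abbreviation point :: "nat \<Rightarrow> nat" where "point s \<equiv> pfst s"
abbreviation bound :: "nat \<Rightarrow> nat" where "bound s \<equiv> pfst (psnd s)"
abbreviation witness :: "nat \<Rightarrow> nat" where "witness s \<equiv> psnd (psnd s)"

text \<open>
  Replacing an almost unitary by its unitary part must not move a tracked element noticeably. As the
  resulting error is proportional to the norm, of which \<open>2 ^ F i\<close> is a bound, the required precision
  includes the exponents of all tracked elements.
\<close>

definition prec :: "nat \<Rightarrow> nat \<Rightarrow> nat" where "prec n M = n + 8 + (\<Sum>i<M. F i)"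

text \<open>
  The precision \<open>d + 2\<close> for the unit leaves a margin in the test: a sufficiently good approximation of
  a unitary passes, and what passes has defects at most \<open>2 / 2 ^ d\<close>.
\<close>

definition near_unitary :: "nat \<Rightarrow> nat \<Rightarrow> bool" where
  "near_unitary c d \<longleftrightarrow>
     small (diff_point_code (one (d + 2)) (mult_code ct (star_code ct c) c)) d \<and>
     small (diff_point_code (one (d + 2)) (mult_code ct c (star_code ct c))) d"

text \<open>
  The target in step \<open>n\<close> is the rational point with code \<open>pfst n\<close>, so that each rational point of \<open>B\<close> is a
  target in arbitrarily late steps, hence at arbitrarily high precision. The precision \<open>n + 4\<close> for the
  values of \<open>\<phi>\<close> keeps the errors of approximation well below the tolerance of the tests.
\<close>

definition step_ok :: "nat \<Rightarrow> nat \<Rightarrow> nat \<Rightarrow> bool" where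
  "step_ok n s t \<longleftrightarrow> bound s < bound t \<and> witness t < bound t \<and>
     near_unitary (point t) (prec (Suc n) (bound t)) \<and>
     (\<forall>i<bound s. small (diff_point_code (conj_code ct (point t) (f i (n + 4)))
                                          (conj_code ct (point s) (f i (n + 4)))) n) \<and>
     small (diff_point_code (conj_code ct (point t) (f (witness t) (n + 4))) (pfst n)) n"

definition valid :: "nat \<Rightarrow> nat \<Rightarrow> bool" where
  "valid n s \<longleftrightarrow> near_unitary (point s) (prec n (bound s))"

lemma computable_step_ok: "computable_pred (\<lambda>z. step_ok (pfst z) (pfst (psnd z)) (psnd (psnd z)))"
  unfolding step_ok_def near_unitary_def prec_def
  by (intro computable_intros small computable_app2[OF f] computable_comp[OF one] computable_comp[OF F])

lemma near_unitary_sound: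
  assumes "near_unitary c d"
  shows "norm (1 - star (y c) * y c) \<le> 2 / 2 ^ d" "norm (1 - y c * star (y c)) \<le> 2 / 2 ^ d"
proof -
  have *: "norm (1 - z) \<le> 2 / 2 ^ d" if "norm (y (one (d + 2)) - z) < 1 / 2 ^ d" for z
  proof -
    have "norm (1 - z) \<le> norm (1 - y (one (d + 2))) + norm (y (one (d + 2)) - z)"
      using norm_triangle_ineq[of "1 - y (one (d + 2))" "y (one (d + 2)) - z"] by simp
    also have "\<dots> \<le> 1 / 2 ^ (d + 2) + 1 / 2 ^ d" using that one_approx[of "d + 2"] by linarith
    also have "\<dots> \<le> 2 / 2 ^ d" by (simp add: field_simps)
    finally show ?thesis .
  qed
  show "norm (1 - star (y c) * y c) \<le> 2 / 2 ^ d" "norm (1 - y c * star (y c)) \<le> 2 / 2 ^ d"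
    using assms unfolding near_unitary_def
    by (auto dest!: small_sound intro!: * simp: rat_point_diff rat_point_mult rat_point_star)
qed

lemma near_unitary_complete:
  assumes "norm (1 - star (y c) * y c) < 1 / 2 ^ (d + 2)" "norm (1 - y c * star (y c)) < 1 / 2 ^ (d + 2)"
  shows "near_unitary c d"
proof -
  have *: "norm (y (one (d + 2)) - z) < 1 / 2 ^ Suc d" if "norm (1 - z) < 1 / 2 ^ (d + 2)" for z
  proof -
    have "norm (y (one (d + 2)) - z) \<le> norm (1 - z) + norm (1 - y (one (d + 2)))"
      using norm_triangle_ineq4[of "1 - z" "1 - y (one (d + 2))"] by simp
    also have "\<dots> < 1 / 2 ^ (d + 2) + 1 / 2 ^ (d + 2)" using that one_approx[of "d + 2"] by linarith
    also have "\<dots> = 1 / 2 ^ Suc d" by (simp add: field_simps)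
    finally show ?thesis .
  qed
  show ?thesis
    unfolding near_unitary_def
    using *[OF assms(1)] *[OF assms(2)]
    by (auto intro!: small_complete simp: rat_point_diff rat_point_mult rat_point_star)
qed

lemma ex_near_unitary:
  assumes "unitary u" and P: "\<forall>\<^sub>F z in nhds u. P z"
  obtains c where "near_unitary c d" "P (y c)"
proof -
  have id: "((\<lambda>z. z) \<longlongrightarrow> u) (nhds u)" by (rule filterlim_ident)
  have "((\<lambda>z. norm (1 - star z * z)) \<longlongrightarrow> norm (1 - star u * u)) (nhds u)"
    "((\<lambda>z. norm (1 - z * star z)) \<longlongrightarrow> norm (1 - u * star u)) (nhds u)"
    by (intro tendsto_intros id)+
  then have "\<forall>\<^sub>F z in nhds u. norm (1 - star z * z) < 1 / 2 ^ (d + 2)"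
    "\<forall>\<^sub>F z in nhds u. norm (1 - z * star z) < 1 / 2 ^ (d + 2)"
    using assms(1) by (auto elim!: order_tendstoD simp: unitary_def)
  with P have "\<forall>\<^sub>F z in nhds u. P z \<and> norm (1 - star z * z) < 1 / 2 ^ (d + 2)
      \<and> norm (1 - z * star z) < 1 / 2 ^ (d + 2)" by (intro eventually_conj)
  from open_rat_point[OF pres_b this] show ?thesis using that near_unitary_complete by blast
qed

text \<open>
  The limit of Newton's iteration can stand in for the rational point it starts from: conjugation by
  either of the two has almost the same effect on tracked elements.
\<close>

lemma unitary_part:
  assumes "valid n s"
  obtains v where "unitary v" "\<And>k. norm (v - (newton ^^ k) (y (point s))) < 1 / 2 ^ k"
    "\<And>i. i < bound s \<Longrightarrow>
       norm (conj_by v (\<phi> (x i)) - conj_by (y (point s)) (\<phi> (x i))) \<le> 1 / 16 / 2 ^ n"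
proof -
  define d where "d = prec n (bound s)"
  define \<epsilon> :: real where "\<epsilon> = 2 / 2 ^ d"
  have d8: "d \<ge> 8" by (simp add: d_def prec_def)
  have \<epsilon>8: "\<epsilon> \<le> 1 / 128"
    using power_increasing[OF d8, of "2::real"] by (simp add: \<epsilon>_def field_simps)
  have \<epsilon>0: "\<epsilon> > 0" by (simp add: \<epsilon>_def)
  have defect: "norm (1 - star (y (point s)) * y (point s)) \<le> \<epsilon>"
    "norm (1 - y (point s) * star (y (point s))) \<le> \<epsilon>"
    using near_unitary_sound assms by (auto simp: valid_def d_def \<epsilon>_def)
  obtain v where v: "unitary v" "\<And>k. norm (v - (newton ^^ k) (y (point s))) \<le> 2 * \<epsilon> / 2 ^ k"
    using newton_limit[OF defect] \<epsilon>8 by auto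
  show ?thesis
  proof (rule that[OF v(1)])
    fix k
    have "2 * \<epsilon> / 2 ^ k < 1 / 2 ^ k" using \<epsilon>8 by (intro divide_strict_right_mono) auto
    with v(2)[of k] show "norm (v - (newton ^^ k) (y (point s))) < 1 / 2 ^ k" by linarith
  next
    fix i assume i: "i < bound s"
    have nv: "norm v \<le> 1" using v(1) unitary_norm_le by (auto simp: unitary_def)
    have diff: "norm (v - y (point s)) \<le> 2 * \<epsilon>" using v(2)[of 0] by simp
    have "norm (y (point s)) \<le> norm v + norm (v - y (point s))"
      using norm_triangle_ineq4[of v "v - y (point s)"] by simp
    then have sum: "norm v + norm (y (point s)) \<le> 3" using nv diff \<epsilon>8 by linarith
    have "norm (\<phi> (x i)) \<le> 2 ^ F i" using star_hom_norm_le[OF hom] F_bound order_trans by blast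
    also have "\<dots> \<le> 2 ^ (\<Sum>i<bound s. F i)"
      using i by (intro power_increasing member_le_sum) auto
    finally have "norm (conj_by v (\<phi> (x i)) - conj_by (y (point s)) (\<phi> (x i)))
        \<le> (2 * \<epsilon>) * 3 * 2 ^ (\<Sum>i<bound s. F i)"
      using diff sum by (intro order_trans[OF norm_conj_by_diff_le] mult_mono) (use \<epsilon>0 in \<open>auto intro!: mult_nonneg_nonneg\<close>)
    also have "\<dots> = 12 / 256 / 2 ^ n"
      by (simp add: \<epsilon>_def d_def prec_def power_add)
    also have "\<dots> \<le> 1 / 16 / 2 ^ n" by (simp add: field_simps)
    finally show "norm (conj_by v (\<phi> (x i)) - conj_by (y (point s)) (\<phi> (x i))) \<le> 1 / 16 / 2 ^ n" .
  qed
qed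

lemma conj_by_approx:
  assumes "near_unitary c d" "d \<ge> 1"
  shows "norm (conj_by (y c) (\<phi> (x i)) - conj_by (y c) (y (f i k))) \<le> 2 / 2 ^ k"
proof -
  have "2 / 2 ^ d \<le> (1::real)"
    using power_increasing[OF assms(2), of "2::real"] by (simp add: field_simps)
  then have "norm (1 - star (y c) * y c) \<le> 1" using near_unitary_sound(1)[OF assms(1)] by linarith
  then have "norm (y c) * norm (y c) \<le> 2" by (rule norm_sq_le_if_defect)
  then have "norm (y c) * norm (y c) * norm (\<phi> (x i) - y (f i k)) \<le> 2 * (1 / 2 ^ k)"
    using f_approx[of i k] by (intro mult_mono) auto
  with norm_conj_by_le[of "y c" "\<phi> (x i) - y (f i k)"] show ?thesis by (simp add: conj_by_diff)
qed

lemma prec_ge_1: "1 \<le> prec n M" by (simp add: prec_def)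

lemma step_ok_sound:
  assumes s: "valid n s" and t: "step_ok n s t"
  shows "valid (Suc n) t"
    and "i < bound s \<Longrightarrow>
      norm (conj_by (y (point t)) (\<phi> (x i)) - conj_by (y (point s)) (\<phi> (x i))) \<le> 2 / 2 ^ n"
    and "norm (conj_by (y (point t)) (\<phi> (x (witness t))) - y (pfst n)) \<le> 2 / 2 ^ n"
proof -
  have nt: "near_unitary (point t) (prec (Suc n) (bound t))" using t by (simp add: step_ok_def)
  then show "valid (Suc n) t" by (simp add: valid_def)
  have ns: "near_unitary (point s) (prec n (bound s))" using s by (simp add: valid_def)
  note at = conj_by_approx[OF nt prec_ge_1, of _ "n + 4"]
  note as = conj_by_approx[OF ns prec_ge_1, of _ "n + 4"]
  show "norm (conj_by (y (point t)) (\<phi> (x i)) - conj_by (y (point s)) (\<phi> (x i))) \<le> 2 / 2 ^ n"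
    if "i < bound s"
  proof -
    have "norm (conj_by (y (point t)) (y (f i (n + 4))) - conj_by (y (point s)) (y (f i (n + 4)))) < 1 / 2 ^ n"
      using t that small_sound by (fastforce simp: step_ok_def rat_point_diff rat_point_conj)
    moreover have "2 / 2 ^ (n + 4) + 1 / 2 ^ n + 2 / 2 ^ (n + 4) \<le> (2 :: real) / 2 ^ n"
      by (simp add: power_add field_simps)
    moreover have "norm (conj_by (y (point t)) (\<phi> (x i)) - conj_by (y (point s)) (\<phi> (x i)))
      \<le> norm (conj_by (y (point t)) (\<phi> (x i)) - conj_by (y (point t)) (y (f i (n + 4))))
       + norm (conj_by (y (point t)) (y (f i (n + 4))) - conj_by (y (point s)) (y (f i (n + 4))))
       + norm (conj_by (y (point s)) (\<phi> (x i)) - conj_by (y (point s)) (y (f i (n + 4))))"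
      by norm
    ultimately show ?thesis using at[of i] as[of i] by linarith
  qed
  have "norm (conj_by (y (point t)) (y (f (witness t) (n + 4))) - y (pfst n)) < 1 / 2 ^ n"
    using t small_sound by (fastforce simp: step_ok_def rat_point_diff rat_point_conj)
  moreover have "2 / 2 ^ (n + 4) + 1 / 2 ^ n \<le> (2 :: real) / 2 ^ n"
    by (simp add: power_add field_simps)
  ultimately show "norm (conj_by (y (point t)) (\<phi> (x (witness t))) - y (pfst n)) \<le> 2 / 2 ^ n"
    using at[of "witness t"]
      norm_triangle_ineq[of "conj_by (y (point t)) (\<phi> (x (witness t))) - conj_by (y (point t)) (y (f (witness t) (n + 4)))"
        "conj_by (y (point t)) (y (f (witness t) (n + 4))) - y (pfst n)"] by simp
qed

text \<open>
  The hypotheses on \<open>w\<close> provide a unitary \<open>u\<close> that meets the requirements with a margin, together with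
  the index \<open>e\<close>. Only then the new bound, and with it the precision, is fixed, and \<open>u\<close> is
  approximated accordingly by a rational point.
\<close>

lemma ex_step_ok:
  assumes s: "valid n s" shows "\<exists>t. step_ok n s t"
proof -
  obtain v where v: "unitary v" and vs: "\<And>i. i < bound s \<Longrightarrow>
      norm (conj_by v (\<phi> (x i)) - conj_by (y (point s)) (\<phi> (x i))) \<le> 1 / 16 / 2 ^ n"
    using unitary_part[OF s] by metis
  define \<epsilon> :: real where "\<epsilon> = 1 / 16 / 2 ^ n"
  have \<epsilon>: "\<epsilon> > 0" by (simp add: \<epsilon>_def)
  obtain u e where u: "unitary u" and ue: "norm (conj_by u (\<phi> (x e)) - y (pfst n)) < \<epsilon>"
    and uv: "\<And>i. i < bound s \<Longrightarrow> norm (conj_by u (\<phi> (x i)) - conj_by v (\<phi> (x i))) < \<epsilon>"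
  proof (rule intertwining_step[OF hom w comm absorb v _ rat_points_dense[OF pres_a] \<epsilon>])
    show "finite (x ` {..<bound s})" by simp
    fix u z assume *: "unitary u" "z \<in> range x" "norm (conj_by u (\<phi> z) - y (pfst n)) < \<epsilon>"
      "\<And>z. z \<in> x ` {..<bound s} \<Longrightarrow> norm (conj_by u (\<phi> z) - conj_by v (\<phi> z)) < \<epsilon>"
    from *(2) obtain e where "z = x e" by blast
    with * show thesis by (intro that[of u e]) auto
  qed
  define M where "M = Suc (bound s + e)"
  have lim: "((\<lambda>z. norm (conj_by z p - q)) \<longlongrightarrow> norm (conj_by u p - q)) (nhds u)" for p q
    by (intro tendsto_intros filterlim_ident)
  have "\<forall>\<^sub>F z in nhds u. \<forall>i\<in>{..<bound s}. norm (conj_by z (\<phi> (x i)) - conj_by v (\<phi> (x i))) < \<epsilon>"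
    using uv by (intro eventually_ball_finite ballI order_tendstoD(2)[OF lim]) auto
  moreover have "\<forall>\<^sub>F z in nhds u. norm (conj_by z (\<phi> (x e)) - y (pfst n)) < \<epsilon>"
    by (rule order_tendstoD(2)[OF lim ue])
  ultimately have "\<forall>\<^sub>F z in nhds u. (\<forall>i\<in>{..<bound s}. norm (conj_by z (\<phi> (x i)) - conj_by v (\<phi> (x i))) < \<epsilon>)
      \<and> norm (conj_by z (\<phi> (x e)) - y (pfst n)) < \<epsilon>" by (rule eventually_conj)
  then obtain c where c: "near_unitary c (prec (Suc n) M)"
    "\<And>i. i < bound s \<Longrightarrow> norm (conj_by (y c) (\<phi> (x i)) - conj_by v (\<phi> (x i))) < \<epsilon>"
    "norm (conj_by (y c) (\<phi> (x e)) - y (pfst n)) < \<epsilon>"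
    by (rule ex_near_unitary[OF u, where d="prec (Suc n) M"]) auto
  have ns: "near_unitary (point s) (prec n (bound s))" using s by (simp add: valid_def)
  note at = conj_by_approx[OF c(1) prec_ge_1, of _ "n + 4"]
  note as = conj_by_approx[OF ns prec_ge_1, of _ "n + 4"]
  have "2 / 2 ^ (n + 4) = 2 * \<epsilon>" and half: "8 * \<epsilon> = 1 / 2 ^ Suc n"
    by (simp_all add: \<epsilon>_def power_add)
  note at = at[unfolded this(1)] and as = as[unfolded this(1)]
  have "norm (conj_by (y c) (y (f i (n + 4))) - conj_by (y (point s)) (y (f i (n + 4)))) < 1 / 2 ^ Suc n"
    if "i < bound s" for i
  proof -
    have "norm (conj_by (y c) (y (f i (n + 4))) - conj_by (y (point s)) (y (f i (n + 4))))
      \<le> norm (conj_by (y c) (\<phi> (x i)) - conj_by (y c) (y (f i (n + 4))))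
       + norm (conj_by (y c) (\<phi> (x i)) - conj_by v (\<phi> (x i)))
       + norm (conj_by v (\<phi> (x i)) - conj_by (y (point s)) (\<phi> (x i)))
       + norm (conj_by (y (point s)) (\<phi> (x i)) - conj_by (y (point s)) (y (f i (n + 4))))"
      by norm
    then show ?thesis
      using at[of i] as[of i] c(2)[OF that] vs[OF that] half \<epsilon> unfolding \<epsilon>_def[symmetric] by linarith
  qed
  moreover have "norm (conj_by (y c) (y (f e (n + 4))) - y (pfst n)) < 1 / 2 ^ Suc n"
  proof -
    have "norm (conj_by (y c) (y (f e (n + 4))) - y (pfst n))
      \<le> norm (conj_by (y c) (\<phi> (x e)) - conj_by (y c) (y (f e (n + 4))))
       + norm (conj_by (y c) (\<phi> (x e)) - y (pfst n))" by norm
    then show ?thesis using at[of e] c(3) half \<epsilon> by linarith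
  qed
  ultimately have "step_ok n s (prod_encode (c, prod_encode (M, e)))"
    using c(1) by (auto simp: step_ok_def M_def intro!: small_complete simp: rat_point_diff rat_point_conj)
  then show ?thesis ..
qed


lemma ex_intertwining_sequence:
  obtains s where "computable_fun s" "\<And>n. valid n (s n)" "\<And>n. step_ok n (s n) (s (Suc n))"
proof -
  obtain c where "near_unitary c 8"
    by (rule ex_near_unitary[of 1 "\<lambda>_. True" 8]) (auto simp: unitary_def)
  then have "valid 0 (prod_encode (c, prod_encode (0, 0)))" by (simp add: valid_def prec_def)
  then show ?thesis
    by (rule effective_dependent_choice[where P=step_ok and I=valid, OF computable_step_ok])
       (erule ex_step_ok, erule (1) step_ok_sound(1), rule that)
qed

text \<open>
  The tracked elements exhaust the rational points because the bounds increase, so conjugation by the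
  unitary parts \<open>v n\<close> converges. An element tracked at stage \<open>n\<close> is within \<open>6 / 2 ^ n\<close> of its limit,
  which makes the limit and the equivalence effective. To compute the inverse at \<open>y j\<close>, no search is
  left to do: the step \<open>prod_encode (j, k + 4)\<close> has \<open>y j\<close> as its target and precision at least \<open>k + 4\<close>,
  so its witness is a preimage up to the required error.
\<close>

lemma ex_intertwining_limit:
  "\<exists>\<psi>. computable_isomorphism ct a b \<psi> \<and> computably_approx_unitarily_equivalent ct a b \<phi> \<psi>"
proof -
  obtain s where s: "computable_fun s" "\<And>n. valid n (s n)" "\<And>n. step_ok n (s n) (s (Suc n))"
    using ex_intertwining_sequence by blast
  define c where "c n = point (s n)" for n
  define M where "M n = bound (s n)" for n
  define e where "e n = witness (s (Suc n))" for n
  have c: "computable_fun c" and e: "computable_fun e"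
    unfolding c_def e_def by (intro computable_intros computable_comp[OF s(1)])+
  have M_Suc: "M n < M (Suc n)" and e_less: "e n < M (Suc n)" for n
    using s(3)[of n] by (auto simp: step_ok_def M_def e_def)
  have M_mono: "M m \<le> M n" if "m \<le> n" for m n
    by (rule lift_Suc_mono_le[of M, OF less_imp_le[OF M_Suc] that])
  have M_ge: "n \<le> M n" for n
  proof (induction n)
    case (Suc n) then show ?case using M_Suc[of n] by linarith
  qed simp
  have "\<forall>n. \<exists>v. unitary v \<and> (\<forall>k. norm (v - (newton ^^ k) (y (c n))) < 1 / 2 ^ k) \<and>
      (\<forall>i<M n. norm (conj_by v (\<phi> (x i)) - conj_by (y (c n)) (\<phi> (x i))) \<le> 1 / 16 / 2 ^ n)"
    using unitary_part[OF s(2)] unfolding c_def M_def by metis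
  then obtain v where v: "\<And>n. unitary (v n)"
    and v_newton: "\<And>n k. norm (v n - (newton ^^ k) (y (c n))) < 1 / 2 ^ k"
    and v_c: "\<And>n i. i < M n \<Longrightarrow> norm (conj_by (v n) (\<phi> (x i)) - conj_by (y (c n)) (\<phi> (x i))) \<le> 1 / 16 / 2 ^ n"
    by metis
  have iso: "norm (\<phi> z) = norm z" for z by (rule inj_star_hom_norm_eq[OF hom inj])
  have step: "norm (conj_by (v (Suc n)) (\<phi> (x i)) - conj_by (v n) (\<phi> (x i))) \<le> 3 / 2 ^ n"
    if "i < M n" for i n
  proof -
    have "norm (conj_by (v (Suc n)) (\<phi> (x i)) - conj_by (v n) (\<phi> (x i)))
      \<le> norm (conj_by (v (Suc n)) (\<phi> (x i)) - conj_by (y (c (Suc n))) (\<phi> (x i)))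
       + norm (conj_by (y (c (Suc n))) (\<phi> (x i)) - conj_by (y (c n)) (\<phi> (x i)))
       + norm (conj_by (v n) (\<phi> (x i)) - conj_by (y (c n)) (\<phi> (x i)))" by norm
    moreover have "norm (conj_by (y (c (Suc n))) (\<phi> (x i)) - conj_by (y (c n)) (\<phi> (x i))) \<le> 2 / 2 ^ n"
      using step_ok_sound(2)[OF s(2,3)] that by (simp add: c_def M_def)
    moreover have "1 / 16 / 2 ^ Suc n + 2 / 2 ^ n + 1 / 16 / 2 ^ n \<le> (3::real) / 2 ^ n"
      by (simp add: field_simps)
    ultimately show ?thesis using v_c[OF that] v_c[of i "Suc n"] that M_Suc[of n] by linarith
  qed
  have tail: "\<exists>L. (\<lambda>k. conj_by (v k) (\<phi> (x i))) \<longlonglongrightarrow> L \<and>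
      (\<forall>k\<ge>n. norm (L - conj_by (v k) (\<phi> (x i))) \<le> 2 * 3 / 2 ^ k)" if "i < M n" for i n
    by (rule geometric_tail_limit) (use that M_mono step in \<open>meson less_le_trans\<close>)
  have conv: "convergent (\<lambda>n. conj_by (v n) (\<phi> z))" if "z \<in> range x" for z
  proof -
    obtain i where "z = x i" using \<open>z \<in> range x\<close> by auto
    moreover have "i < M (Suc i)" using M_ge[of "Suc i"] by linarith
    ultimately show ?thesis using tail[of i "Suc i"] by (auto simp: convergent_def)
  qed
  obtain \<psi> where \<psi>: "star_hom \<psi>" and \<psi>_iso: "\<And>z. norm (\<psi> z) = norm z"
    and \<psi>_lim: "\<And>z. (\<lambda>n. conj_by (v n) (\<phi> z)) \<longlonglongrightarrow> \<psi> z"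
    using star_hom_conj_by_limit[OF hom iso v rat_points_dense[OF pres_a] conv] by blast
  have rate: "norm (\<psi> (x i) - conj_by (v n) (\<phi> (x i))) \<le> 6 / 2 ^ n" if "i < M n" for i n
    using tail[OF that] LIMSEQ_unique[OF \<psi>_lim] by fastforce
  have target: "norm (\<psi> (x (e n)) - y (pfst n)) \<le> 6 / 2 ^ n" for n
  proof -
    have "norm (\<psi> (x (e n)) - y (pfst n)) \<le> norm (\<psi> (x (e n)) - conj_by (v (Suc n)) (\<phi> (x (e n))))
       + norm (conj_by (v (Suc n)) (\<phi> (x (e n))) - conj_by (y (c (Suc n))) (\<phi> (x (e n))))
       + norm (conj_by (y (c (Suc n))) (\<phi> (x (e n))) - y (pfst n))" by norm
    moreover have "norm (conj_by (y (c (Suc n))) (\<phi> (x (e n))) - y (pfst n)) \<le> 2 / 2 ^ n"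
      using step_ok_sound(3)[OF s(2,3)] by (simp add: c_def e_def)
    moreover have "6 / 2 ^ Suc n + 1 / 16 / 2 ^ Suc n + 2 / 2 ^ n \<le> (6::real) / 2 ^ n"
      by (simp add: field_simps)
    ultimately show ?thesis using rate[OF e_less[of n]] v_c[OF e_less[of n]] by linarith
  qed
  have less_eps: "9 / 2 ^ n < (1::real) / 2 ^ k" if "k + 4 \<le> n" for n k
  proof -
    have "(16::real) * 2 ^ k \<le> 2 ^ n" using power_increasing[OF that, of "2::real"] by (simp add: power_add)
    moreover have "(0::real) < 2 ^ k" by simp
    ultimately have "9 * 2 ^ k < (2::real) ^ n" by linarith
    then show ?thesis by (simp add: field_simps)
  qed
  have inverse: "norm (\<psi> (x (e (prod_encode (j, k + 4)))) - y j) < 1 / 2 ^ k" for j k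
  proof -
    have "6 / 2 ^ prod_encode (j, k + 4) \<le> (9::real) / 2 ^ prod_encode (j, k + 4)"
      by (intro divide_right_mono) auto
    with target[of "prod_encode (j, k + 4)"] less_eps[OF le_prod_encode_2[of "k + 4" j]]
    show ?thesis by simp
  qed
  have "bij \<psi>"
  proof (rule isometric_hom_bij_if_dense_range[OF \<psi> \<psi>_iso])
    have "y j \<in> closure (range \<psi>)" for j
      unfolding closure_approachable
    proof (intro allI impI)
      fix \<epsilon> :: real assume "\<epsilon> > 0"
      then obtain k where "(1/2) ^ k < \<epsilon>" using real_arch_pow_inv[of \<epsilon> "1/2"] by auto
      then show "\<exists>z\<in>range \<psi>. dist z (y j) < \<epsilon>"
        using inverse[of j k] by (intro bexI[OF _ rangeI[of \<psi> "x (e (prod_encode (j, k + 4)))"]]) (auto simp: dist_norm power_one_over)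
    qed
    then have "closure (range y) \<subseteq> closure (range \<psi>)" by (intro closure_minimal) auto
    then show "closure (range \<psi>) = UNIV" using rat_points_dense[OF pres_b] by auto
  qed
  have "computable_map ct a b \<psi>"
    unfolding computable_map_def
  proof (intro exI conjI allI)
    show "computable_fun2 (\<lambda>i k. conj_code ct (c (i + k + 4)) (f i (i + k + 4)))"
      unfolding computable_fun2_iff
      by (intro computable_intros computable_comp[OF c] computable_app2[OF f])
    fix i k :: nat
    define n where "n = i + k + 4"
    have i: "i < M n" using M_ge[of n] by (simp add: n_def)
    have "near_unitary (c n) (prec n (M n))" using s(2)[of n] by (simp add: valid_def c_def M_def)
    note approx = conj_by_approx[OF this prec_ge_1, of i n]
    have "norm (\<psi> (x i) - conj_by (y (c n)) (y (f i n)))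
      \<le> norm (\<psi> (x i) - conj_by (v n) (\<phi> (x i)))
       + norm (conj_by (v n) (\<phi> (x i)) - conj_by (y (c n)) (\<phi> (x i)))
       + norm (conj_by (y (c n)) (\<phi> (x i)) - conj_by (y (c n)) (y (f i n)))" by norm
    also have "\<dots> \<le> 6 / 2 ^ n + 1 / 16 / 2 ^ n + 2 / 2 ^ n"
      by (intro add_mono rate v_c approx i)
    also have "\<dots> \<le> 9 / 2 ^ n" by (simp add: field_simps)
    also have "\<dots> < 1 / 2 ^ k" by (rule less_eps) (simp add: n_def)
    finally show "norm (\<psi> (x i) - y (conj_code ct (c (i + k + 4)) (f i (i + k + 4)))) < 1 / 2 ^ k"
      by (simp add: rat_point_conj n_def)
  qed
  moreover have "computable_map ct b a (inv \<psi>)"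
    unfolding computable_map_def
  proof (intro exI conjI allI)
    show "computable_fun2 (\<lambda>j k. e (prod_encode (j, k + 4)))"
      unfolding computable_fun2_iff by (intro computable_intros computable_comp[OF e])
    fix j k :: nat
    have "\<psi> (inv \<psi> (y j)) = y j" using \<open>bij \<psi>\<close> by (simp add: bij_is_surj surj_f_inv_f)
    then have "norm (inv \<psi> (y j) - x (e (prod_encode (j, k + 4))))
        = norm (y j - \<psi> (x (e (prod_encode (j, k + 4)))))"
      using \<psi>_iso[of "inv \<psi> (y j) - x (e (prod_encode (j, k + 4)))"] by (simp add: star_hom_diff[OF \<psi>])
    then show "norm (inv \<psi> (y j) - x (e (prod_encode (j, k + 4)))) < 1 / 2 ^ k"
      using inverse[of j k] by (simp add: norm_minus_commute)
  qed
  ultimately have "computable_isomorphism ct a b \<psi>"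
    using \<psi> \<open>bij \<psi>\<close> by (simp add: computable_isomorphism_def star_iso_def)
  moreover have "computably_approx_unitarily_equivalent ct a b \<phi> \<psi>"
    unfolding computably_approx_unitarily_equivalent_def
  proof (intro exI conjI allI)
    show "computable_sequence ct b v"
    proof -
      have "computable_fun2 (\<lambda>n k. (newton_code ct ^^ k) (c n))"
        unfolding computable_fun2_iff
        by (intro computable_intros computable_comp[OF c])
      then obtain p where p: "computable_fun (\<lambda>n. prog_code (p n))"
        "\<And>n k. runs (p n) k ((newton_code ct ^^ k) (c n))"
        using computable_specialization by blast
      have "point_code ct b (prog_code (p n)) (v n)" for n
        unfolding point_code_def
        using p(2)[of n] v_newton[of n] by (intro exI[of _ "p n"]) (auto simp flip: rat_point_newton_funpow)
      with p(1) show ?thesis unfolding computable_sequence_def by blast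
    qed
    show "unitary (v n)" for n by (rule v)
    show "computable_fun2 (\<lambda>i m. i + m + 4)" unfolding computable_fun2_iff by (intro computable_intros)
    fix i m :: nat
    have "norm (\<psi> (x i) - conj_by (v (i + m + 4)) (\<phi> (x i))) \<le> 6 / 2 ^ (i + m + 4)"
      using M_ge[of "i + m + 4"] by (intro rate) linarith
    also have "\<dots> \<le> 9 / 2 ^ (i + m + 4)" by (intro divide_right_mono) auto
    also have "\<dots> < 1 / 2 ^ m" by (rule less_eps) simp
    finally show "norm (v (i + m + 4) * \<phi> (x i) * star (v (i + m + 4)) - \<psi> (x i)) < 1 / 2 ^ m"
      by (simp add: conj_by_def norm_minus_commute)
  qed
  ultimately show ?thesis by blast
qed

end

theorem theorem3p3:
  fixes ct :: bool
    and a :: "nat \<Rightarrow> 'a::unital_cstar_algebra"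
    and b :: "nat \<Rightarrow> 'b::unital_cstar_algebra"
    and \<phi> :: "'a \<Rightarrow> 'b"
  assumes "separable_space (euclidean :: 'a topology)"
    and "separable_space (euclidean :: 'b topology)"
    and "star_hom \<phi>" and "inj \<phi>"
    and "computable_presentation ct a"
    and "computable_presentation ct b"
    and "computable_point ct b 1"
    and "computable_map ct a b \<phi>"
    and "\<exists>w :: nat \<Rightarrow> 'b. (\<forall>n. unitary (w n)) \<and>
           (\<forall>x. (\<lambda>n. norm (w n * \<phi> x - \<phi> x * w n)) \<longlonglongrightarrow> 0) \<and>
           (\<forall>y. (\<lambda>n. infdist (star (w n) * y * w n) (range \<phi>)) \<longlonglongrightarrow> 0)"
  shows "\<exists>\<psi> :: 'a \<Rightarrow> 'b. computable_isomorphism ct a b \<psi> \<and>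
           computably_approx_unitarily_equivalent ct a b \<phi> \<psi>"
proof -
  obtain w where w: "\<And>n. unitary (w n)" "\<And>x. (\<lambda>n. norm (w n * \<phi> x - \<phi> x * w n)) \<longlonglongrightarrow> 0"
    "\<And>y. (\<lambda>n. infdist (star (w n) * y * w n) (range \<phi>)) \<longlonglongrightarrow> 0"
    using assms(9) by blast
  obtain f where f: "computable_fun2 f"
    "\<And>i k. norm (\<phi> (rat_point ct a i) - rat_point ct b (f i k)) < 1 / 2 ^ k"
    using assms(8) unfolding computable_map_def by blast
  obtain p where "\<forall>k. \<exists>n. runs p k n \<and> norm (1 - rat_point ct b n) < 1 / 2 ^ k"
    using assms(7) unfolding computable_point_def point_code_def by blast
  then obtain one where one: "\<And>k. runs p k (one k)" "\<And>k. norm (1 - rat_point ct b (one k)) < 1 / 2 ^ k"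
    by metis
  have one': "computable_fun one" using one(1) unfolding computable_fun_def by blast
  obtain F where F: "computable_fun F" "\<And>i. norm (rat_point ct a i) \<le> 2 ^ F i"
    using computable_norm_bound[OF assms(5)] by blast
  obtain small where small:
    "\<And>f g. computable_fun f \<Longrightarrow> computable_fun g \<Longrightarrow> computable_pred (\<lambda>x. small (f x) (g x))"
    "\<And>i n. norm (rat_point ct b i) < 1 / 2 ^ Suc n \<Longrightarrow> small i n"
    "\<And>i n. small i n \<Longrightarrow> norm (rat_point ct b i) < 1 / 2 ^ n"
    by (rule small_test[OF assms(6)]) blast
  interpret effective_intertwining ct a b \<phi> w f one F small
    using assms w f one one' F small
    by unfold_locales (auto simp: computable_presentation_def)
  show ?thesis by (rule ex_intertwining_limit)
qed

end
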